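(* Let $v\in(\mathbb{R}\setminus\{0\})^n$ be such that not all entries are positive and not all entries are negative. Define $P:=\operatorname{span}\{v\}\oplus[0,\infty)^n\subset\mathbb{R}^n$, and let $g\sim\mathcal{N}(0,1)$. Then for all $k\in\{1,\dots,n-1\}$, $$ \nu_{n-k}(P)=\sum_{\substack{L\subset\{l\in[n]:v_l>0\},\ R\subset\{r\in[n]:v_r<0\}\\|L|+|R|=k+1}}\mathbb{E}\left[\prod_{j\in L\cup R}\Phi\left(\frac{igv_j}{\|v\|_{LR}}\right)\right]\mathbb{E}\left[\prod_{j\in[n]\setminus(L\cup R)}\Phi\left(\frac{gv_j}{\|v\|_{LR}}\right)\right]. $$ Moreover, $$ \nu_0(P)=0,\qquad \nu_n(P)=1-\sum_{k=0}^{n-1}\nu_k(P). $$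
   Context: $[n]:=\{1,\dots,n\}$, $i:=\sqrt{-1}$, $A\oplus B:=\{a+b:a\in A,b\in B\}$, $\|v\|_{LR}^2:=\sum_{j\in L\cup R}v_j^2$. $\Phi:\mathbb{C}\to\mathbb{C}$, $\Phi(z):=\frac12+\frac{1}{\sqrt{2\pi}}\int_0^ze^{-t^2/2}\,dt$. For a polyhedral cone $C\subset\mathbb{R}^n$ and $k\in\{0,\dots,n\}$, the $k$-th intrinsic volume $\nu_k(C)$ is the probability that the Euclidean projection onto $C$ of a standard Gaussian vector in $\mathbb{R}^n$ lies in the relative interior of some $k$-dimensional face of $C$. *)

theory Defs
  imports "HOL-Probability.Probability" "HOL-Complex_Analysis.Complex_Analysis"
    "HOL-Library.Set_Algebras"
begin

text \<open>
  The integrand is entire, so integrating along the straight segment from \<open>0\<close> to \<open>z\<close>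
  realises the path-independent complex integral.
\<close>
definition Phi :: "complex \<Rightarrow> complex" where
  "Phi z = 1/2 + 1 / of_real (sqrt (2 * pi)) *
     contour_integral (linepath 0 z) (\<lambda>t. exp (- (t\<^sup>2) / 2))"

definition std_gaussian :: "(real ^ 'n) measure" where
  "std_gaussian = density lborel (\<lambda>x. ennreal (\<Prod>j\<in>UNIV. std_normal_density (x $ j)))"

text \<open>
  Meant for polyhedral cones \<open>C\<close> in dimension \<open>n = CARD('n)\<close>, with \<open>k \<le> n\<close>;
  \<open>C\<close> itself counts as a face. The predicate \<open>face_of\<close> also admits the empty set, which is
  harmless because its affine dimension is \<open>-1\<close>.
\<close>
definition intrinsic_volume :: "nat \<Rightarrow> (real ^ 'n) set \<Rightarrow> real" where
  "intrinsic_volume k C = measure std_gaussian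
     {x. \<exists>F. F face_of C \<and> aff_dim F = int k \<and> closest_point C x \<in> rel_interior F}"

definition nonneg_orthant :: "(real ^ 'n) set" where
  "nonneg_orthant = {x. \<forall>j. 0 \<le> x $ j}"

definition norm_on :: "'n set \<Rightarrow> real ^ 'n \<Rightarrow> real" where
  "norm_on S v = sqrt (\<Sum>j\<in>S. (v $ j)\<^sup>2)"

end

(*
  The dual cone of P is the intersection of the orthant with the hyperplane orthogonal to v.
  For almost every x outside P, with projection p onto P, the residual y = p - x is positive on a set S
  and zero elsewhere, while p = l v + a with a zero on S and positive elsewhere; here l is
  (sum over S of x_j v_j) / |v|_S^2. Hence p lies in the relative interior of a face of dimension
  n + 1 - |S|, and the intrinsic volume is the sum of the Gaussian measures of the cells
  {x_j < l v_j on S, x_j > l v_j off S}.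

  Put u = v / |v|_S and let W be the scalar product of x and u over S. The residual Y = x - W u on
  S is independent of W, so the measure of a cell factors as
  P(Y_S < 0) * E prod_{j not in S} Phi (g u_j). For the first factor,
  Phi (i y) = exp (y^2/2) E[1(Z < 0) exp (-i y Z)], so that
  E prod_{j in S} Phi (i g u_j) is the integral over y of E[1(X_S < 0) exp (-i y W)] / sqrt (2 pi).
  By Fourier inversion this is sqrt (2 pi) times the density at W = 0 of the law of W restricted
  to {X_S < 0}, that is, P(Y_S < 0). The inversion is carried out with a Gaussian regularization
  exp (- y^2 / (2 c^2)), c -> infinity; integrability in y needs |S| >= 2. If all entries of v on S
  have the same sign, both sides vanish, so no sign condition on S is required.
*)
theory Submission
  imports Defs "HOL-Real_Asymp.Real_Asymp"
begin

section \<open>The Gaussian integral and its complex extension\<close>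

text \<open>The obstacle is that Fourier inversion at the single point W = 0 is not a Fubini
  argument: the integral of exp (- i y W) over y does not converge absolutely. With the Gaussian
  weight it does, and the y integral becomes the kernel c * exp (- (c W)^2 / 2), which concentrates
  near W = 0. Replacing W by an independent standard normal and rescaling it by c gives integrands
  bounded by 1, so the limit is dominated convergence and no density of the restricted law is ever
  constructed. The assumption \<open>2 \<le> card S\<close> enters on both sides of this limit.
  \<open>half_char\<close> decays only like 1 / |y|, so two factors are needed for integrability;
  and the residual on a one-element set is identically 0, so the limit point would lie on the wall
  of the quadrant. The conditions off S are carried along with constant thresholds, which become w *
  u_j only when the outer integral over W = w is taken.\<close>

definition gauss :: "complex \<Rightarrow> complex" where
  "gauss z = exp (- (z\<^sup>2) / 2) / of_real (sqrt (2 * pi))"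

lemma gauss_of_real: "gauss (of_real x) = of_real (std_normal_density x)"
  by (simp add: gauss_def std_normal_density_def exp_of_real[symmetric])

text \<open>On a horizontal line the modulus is a constant times a real Gaussian, which yields both
  integrability and decay along such lines.\<close>

lemma norm_gauss: "norm (gauss z) = exp ((Im z)\<^sup>2 / 2) * std_normal_density (Re z)"
proof -
  have "Re (- (z\<^sup>2) / 2) = (Im z)\<^sup>2 / 2 + - ((Re z)\<^sup>2 / 2)"
    by (simp add: power2_eq_square field_simps)
  then have "norm (exp (- (z\<^sup>2) / 2)) = exp ((Im z)\<^sup>2 / 2) * exp (- ((Re z)\<^sup>2 / 2))"
    by (metis norm_exp_eq_Re exp_add)
  then show ?thesis
    by (simp add: gauss_def norm_divide std_normal_density_def)
qed

lemma continuous_on_gauss [continuous_intros]: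
  "continuous_on A f \<Longrightarrow> continuous_on A (\<lambda>x. gauss (f x))"
  unfolding gauss_def by (intro continuous_intros) auto

lemma borel_measurable_gauss [measurable]: "gauss \<in> borel_measurable borel"
  by (intro borel_measurable_continuous_onI continuous_intros)

text \<open>The integrand is entire, so it has a primitive \<open>G\<close> on the whole plane, and
  the segment integral is \<open>G w - G 0\<close>. This avoids differentiating a contour integral
  in its endpoint.\<close>

lemma Phi_has_field_derivative: "(Phi has_field_derivative gauss z) (at z)"
proof -
  have "(\<lambda>t::complex. exp (- (t\<^sup>2) / 2)) holomorphic_on UNIV"
    by (intro holomorphic_intros) auto
  then obtain G where G: "\<And>x::complex. (G has_field_derivative exp (- (x\<^sup>2) / 2)) (at x)"
    using holomorphic_convex_primitive'[of UNIV "\<lambda>t. exp (- (t\<^sup>2) / 2)"] by auto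
  have "Phi = (\<lambda>w. 1/2 + 1 / of_real (sqrt (2 * pi)) * (G w - G 0))"
  proof
    fix w
    have "contour_integral (linepath 0 w) (\<lambda>t. exp (- (t\<^sup>2) / 2)) = G w - G 0"
      using contour_integral_primitive[of UNIV G "\<lambda>t. exp (- (t\<^sup>2) / 2)" "linepath 0 w"] G
      by (intro contour_integral_unique) simp
    then show "Phi w = 1/2 + 1 / of_real (sqrt (2 * pi)) * (G w - G 0)"
      by (simp add: Phi_def)
  qed
  moreover have "((\<lambda>w. 1/2 + 1 / of_real (sqrt (2 * pi)) * (G w - G 0)) has_field_derivative gauss z) (at z)"
    unfolding gauss_def by (rule derivative_eq_intros G refl)+ simp
  ultimately show ?thesis by simp
qed

lemma continuous_on_Phi [continuous_intros]:
  "continuous_on A f \<Longrightarrow> continuous_on A (\<lambda>x. Phi (f x))"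
  by (rule continuous_on_compose2[of UNIV Phi])
     (auto intro!: continuous_at_imp_continuous_on DERIV_isCont Phi_has_field_derivative)

lemma borel_measurable_Phi [measurable]: "Phi \<in> borel_measurable borel"
  by (intro borel_measurable_continuous_onI continuous_intros)

lemma integrable_gauss_shift: "integrable lborel (\<lambda>s. gauss (of_real s + z))"
proof (rule Bochner_Integration.integrable_bound)
  show "integrable lborel (\<lambda>s. exp ((Im z)\<^sup>2 / 2) * normal_density (- Re z) 1 s)"
    by (intro integrable_mult_right integrable_normal_density) simp
qed (auto simp: norm_gauss normal_density_def)

section \<open>Phi as a Gaussian integral over a horizontal half-line\<close>

lemma Phi_diff_eq_integral:
  assumes "a \<le> 0"
  shows "Phi z - Phi (of_real a + z) = (LINT s:{a..0}|lborel. gauss (of_real s + z))"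
proof -
  have "(LINT s:{a..0}|lborel. gauss (of_real s + z)) = Phi (of_real 0 + z) - Phi (of_real a + z)"
    unfolding set_lebesgue_integral_def
  proof (rule integral_FTC_atLeastAtMost[OF assms])
    fix s :: real
    have "((\<lambda>w. Phi (w + z)) has_field_derivative gauss (of_real s + z)) (at (of_real s))"
      by (rule DERIV_chain2[OF Phi_has_field_derivative, of _ 1, simplified])
         (auto intro!: derivative_eq_intros)
    then show "((\<lambda>s. Phi (of_real s + z)) has_vector_derivative gauss (of_real s + z))
        (at s within {a..0})"
      by (rule has_vector_derivative_real_field)
  qed (intro continuous_intros)
  then show ?thesis by simp
qed

text \<open>At this stage only the existence of the limit matters; \<open>Phi_eq_integral\<close>
  shows that its value is 0.\<close>

lemma Phi_tendsto_at_bot: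
  "((\<lambda>a. Phi (of_real a + z)) \<longlongrightarrow> Phi z - (LINT s:{..0}|lborel. gauss (of_real s + z))) at_bot"
proof -
  have "((\<lambda>a. LINT s:{a..0}|lborel. gauss (of_real s + z)) \<longlongrightarrow>
      (LINT s:{..0}|lborel. gauss (of_real s + z))) at_bot"
    by (intro tendsto_set_lebesgue_integral_at_bot)
       (auto simp: set_integrable_def intro!: integrable_mult_indicator integrable_gauss_shift)
  then have "((\<lambda>a. Phi z - (LINT s:{a..0}|lborel. gauss (of_real s + z))) \<longlongrightarrow>
      Phi z - (LINT s:{..0}|lborel. gauss (of_real s + z))) at_bot"
    by (intro tendsto_intros)
  then show ?thesis
  proof (rule Lim_transform_eventually)
    show "\<forall>\<^sub>F a in at_bot. Phi z - (LINT s:{a..0}|lborel. gauss (of_real s + z)) = Phi (of_real a + z)"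
      using eventually_le_at_bot[of "0::real"]
      by eventually_elim (simp add: Phi_diff_eq_integral[symmetric])
  qed
qed

lemma Phi_0: "Phi 0 = 1/2"
  by (simp add: Phi_def)

text \<open>By reflection the two half-lines carry equal mass, and they overlap in a null set. This
  matches the constant 1/2 in \<open>Phi\<close>.\<close>

lemma integral_gauss_atMost_0: "(LINT s:{..0}|lborel. gauss (of_real s)) = 1/2"
proof -
  have i: "integrable lborel (\<lambda>s. indicator A s *\<^sub>R gauss (of_real s))" if "A \<in> sets borel" for A
    using integrable_gauss_shift[of 0] that by (intro integrable_mult_indicator) auto
  have "(LINT s:{..0}|lborel. gauss (of_real s)) = (LINT s:{0..}|lborel. gauss (of_real s))"
    unfolding set_lebesgue_integral_def
    by (subst lborel_integral_real_affine[of "-1" _ 0])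
       (auto intro!: Bochner_Integration.integral_cong simp: gauss_def indicator_def)
  moreover have "(LINT s:{..0}|lborel. gauss (of_real s)) + (LINT s:{0..}|lborel. gauss (of_real s))
      = (LINT s|lborel. gauss (of_real s))"
    unfolding set_lebesgue_integral_def
    by (subst Bochner_Integration.integral_add[OF i i, symmetric])
       (use AE_lborel_singleton[of "0::real"] in \<open>auto intro!: integral_cong_AE simp: indicator_def\<close>)
  moreover have "(LINT s|lborel. gauss (of_real s)) = 1"
    by (simp add: gauss_of_real integral_normal_density)
  ultimately show ?thesis by (metis field_sum_of_halves add_left_imp_eq mult_2 nonzero_mult_div_cancel_left zero_neq_numeral)
qed

text \<open>Mean value bound on the segment from \<open>a\<close> to \<open>a + z\<close>, where
  \<open>norm_gauss\<close> controls the derivative. It carries the limit on the real axis over to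
  the horizontal line through \<open>z\<close>.\<close>

lemma Phi_shift_diff_tendsto_0: "((\<lambda>a. Phi (of_real a + z) - Phi (of_real a)) \<longlongrightarrow> 0) at_bot"
proof (rule Lim_null_comparison)
  let ?B = "\<lambda>a. exp ((norm z)\<^sup>2 / 2) * std_normal_density (a + norm z) * norm z"
  show "\<forall>\<^sub>F a in at_bot. norm (Phi (of_real a + z) - Phi (of_real a)) \<le> ?B a"
    using eventually_le_at_bot[of "- norm z"]
  proof eventually_elim
    case (elim a)
    have "norm (Phi (of_real a + z) - Phi (of_real a)) \<le>
      (exp ((norm z)\<^sup>2 / 2) * std_normal_density (a + norm z)) * norm (of_real a + z - of_real a)"
    proof (rule field_differentiable_bound)
      show "(Phi has_field_derivative gauss w) (at w within closed_segment (of_real a) (of_real a + z))" for w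
        by (rule has_field_derivative_at_within) (rule Phi_has_field_derivative)
      fix w assume "w \<in> closed_segment (of_real a) (of_real a + z)"
      then obtain u where u: "0 \<le> u" "u \<le> 1" "w = of_real a + of_real u * z"
        by (auto simp: in_segment algebra_simps scaleR_conv_of_real)
      have "\<bar>u * Im z\<bar> \<le> norm z" "\<bar>u * Re z\<bar> \<le> norm z"
        using u abs_Im_le_cmod[of z] abs_Re_le_cmod[of z]
        by (auto simp: abs_mult intro: order_trans[OF mult_left_le_one_le])
      then have "\<bar>Im w\<bar> \<le> norm z" "Re w \<le> a + norm z"
        using u by auto
      \<comment> \<open>For \<open>a \<le> - norm z\<close> both \<open>Re w\<close> and
        \<open>a + norm z\<close> are nonpositive, so their squares are ordered the opposite
        way.\<close>
      then have "(Im w)\<^sup>2 \<le> (norm z)\<^sup>2" "(a + norm z)\<^sup>2 \<le> (Re w)\<^sup>2"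
        using elim by (auto simp: abs_le_square_iff[symmetric])
      then show "norm (gauss w) \<le> exp ((norm z)\<^sup>2 / 2) * std_normal_density (a + norm z)"
        unfolding norm_gauss std_normal_density_def
        by (intro mult_mono mult_left_mono) auto
    qed auto
    then show ?case by simp
  qed
  have "((\<lambda>a. exp (c\<^sup>2 / 2) * (1 / sqrt (2 * pi) * exp (- (a + c)\<^sup>2 / 2)) * c) \<longlongrightarrow> 0) at_bot" for c :: real
    by real_asymp
  then show "(?B \<longlongrightarrow> 0) at_bot"
    unfolding std_normal_density_def .
qed

text \<open>On the real axis \<open>Phi\<close> tends to 0 at minus infinity, by its value at 0 and
  the half-line integral. The shift estimate gives the same limit along the line through
  \<open>z\<close>, and uniqueness of limits identifies \<open>Phi z\<close> with the
  integral.\<close>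

theorem Phi_eq_integral: "Phi z = (LINT s:{..0}|lborel. gauss (of_real s + z))"
proof -
  have "((\<lambda>a. (Phi (of_real a + z) - Phi (of_real a)) + Phi (of_real a + 0)) \<longlongrightarrow>
      0 + (Phi 0 - (LINT s:{..0}|lborel. gauss (of_real s + 0)))) at_bot"
    by (intro tendsto_add Phi_shift_diff_tendsto_0 Phi_tendsto_at_bot)
  then have "((\<lambda>a. Phi (of_real a + z)) \<longlongrightarrow> 0) at_bot"
    by (simp add: Phi_0 integral_gauss_atMost_0)
  from tendsto_unique[OF _ Phi_tendsto_at_bot this] show ?thesis
    by simp
qed

text \<open>The characteristic function, at \<open>- y\<close>, of the standard normal law restricted to the negative half-line.\<close>

definition half_char :: "real \<Rightarrow> complex" where
  "half_char y = (LINT s:{..0}|lborel. of_real (std_normal_density s) * iexp (- (y * s)))"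

lemma integrable_std_normal_iexp:
  "integrable lborel (\<lambda>s. of_real (std_normal_density s) * iexp (y * s))"
  by (rule Bochner_Integration.integrable_bound[OF integrable_normal_density[of 1 0]])
     (auto simp: norm_mult)

text \<open>Expanding the square (s + i y)^2 = s^2 + 2 i s y - y^2 separates the growing factor from
  an oscillating Gaussian integral.\<close>

lemma Phi_imaginary: "Phi (\<i> * of_real y) = of_real (exp (y\<^sup>2 / 2)) * half_char y"
proof -
  have "gauss (of_real s + \<i> * of_real y) =
      of_real (exp (y\<^sup>2 / 2)) * (of_real (std_normal_density s) * iexp (- (y * s)))" for s
  proof -
    have "- ((of_real s + \<i> * of_real y)\<^sup>2) / 2 =
        of_real (y\<^sup>2 / 2) + (of_real (- s\<^sup>2 / 2) + \<i> * of_real (- (y * s)))"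
      by (simp add: power2_eq_square field_simps)
    then have "exp (- ((of_real s + \<i> * of_real y)\<^sup>2) / 2) =
        of_real (exp (y\<^sup>2 / 2)) * (of_real (exp (- s\<^sup>2 / 2)) * iexp (- (y * s)))"
      by (metis exp_add exp_of_real)
    then show ?thesis
      by (simp add: gauss_def std_normal_density_def)
  qed
  then show ?thesis
    unfolding Phi_eq_integral half_char_def set_lebesgue_integral_def
    by (simp add: mult_scaleR_right[symmetric] del: mult_scaleR_right)
qed

lemma half_char_eq_Phi: "half_char y = of_real (exp (- (y\<^sup>2 / 2))) * Phi (\<i> * of_real y)"
  unfolding Phi_imaginary mult.assoc[symmetric] of_real_mult[symmetric] exp_add[symmetric] by simp

lemma borel_measurable_half_char [measurable]: "half_char \<in> borel_measurable borel"
  unfolding half_char_eq_Phi[abs_def] by measurable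

lemma Phi_of_real: "Phi (of_real x) = of_real (measure std_normal_distribution {..x})"
proof -
  have "Phi (of_real x) = (LINT s|lborel. of_real (indicator {..0} s * std_normal_density (s + x)))"
    unfolding Phi_eq_integral set_lebesgue_integral_def of_real_add[symmetric] gauss_of_real
    by (auto intro!: Bochner_Integration.integral_cong simp: indicator_def)
  also have "\<dots> = of_real (LINT s|lborel. indicator {..0} s * std_normal_density (s + x))"
    by (rule integral_complex_of_real)
  also have "(LINT s|lborel. indicator {..0} s * std_normal_density (s + x)) =
      (LINT s|lborel. indicator {..x} s * std_normal_density s)"
    by (subst (2) lborel_integral_real_affine[of 1 _ x])
       (auto intro!: Bochner_Integration.integral_cong simp: indicator_def add.commute)
  also have "\<dots> = (LINT s|std_normal_distribution. indicator {..x} s)"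
    by (subst integral_density) (auto simp: mult.commute)
  also have "\<dots> = measure std_normal_distribution {..x}"
    by simp
  finally show ?thesis .
qed

section \<open>Size and decay of the half-line characteristic function\<close>

lemma norm_half_char_le_1: "norm (half_char y) \<le> 1"
proof -
  have "norm (half_char y) \<le> (LINT s|lborel. norm (indicator {..0} s *\<^sub>R (of_real (std_normal_density s) * iexp (- (y * s)))))"
    unfolding half_char_def set_lebesgue_integral_def by (rule integral_norm_bound)
  also have "\<dots> \<le> (LINT s|lborel. std_normal_density s)"
    by (rule integral_mono')
       (auto simp: norm_mult indicator_def)
  finally show ?thesis by simp
qed

text \<open>Integration by parts: with \<open>f\<close> the integrand and
  \<open>h s = - s * f s\<close>, the product rule gives f' = h - i y f. Integrating over the
  negative half-line expresses i y \<open>half_char y\<close> through the integrals of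
  \<open>h\<close> and f', both bounded independently of y. The jump of the restricted density at 0
  prevents faster decay.\<close>

lemma norm_half_char_le_inverse:
  obtains C where "C > 0" "\<And>y. \<bar>y\<bar> * norm (half_char y) \<le> C"
proof
  let ?\<phi> = std_normal_density
  let ?A = "LINT s|lborel. ?\<phi> s * \<bar>s\<bar>"
  have intA: "integrable lborel (\<lambda>s. ?\<phi> s * \<bar>s\<bar>)"
    using integrable_std_normal_moment_abs[of 1] by simp
  have A: "?A \<ge> 0" by (rule Bochner_Integration.integral_nonneg) auto
  \<comment> \<open>\<open>2 * std_normal_density 0\<close> bounds the boundary terms and
    \<open>?A\<close>, the first absolute moment, bounds the integral of \<open>h\<close>; the
    summand 1 makes positivity immediate.\<close>
  show "2 * ?\<phi> 0 + ?A + 1 > 0" using A by (simp add: add_nonneg_pos)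
  fix y
  define f where "f = (\<lambda>s. of_real (?\<phi> s) * iexp (- (y * s)))"
  define h where "h = (\<lambda>s. - of_real s * f s)"
  have f_int: "integrable lborel f"
    using integrable_std_normal_iexp[of "- y"] by (simp add: f_def)
  have h_int: "integrable lborel h"
    by (rule Bochner_Integration.integrable_bound[OF intA])
       (auto simp: norm_mult h_def f_def)
  have deriv: "(f has_vector_derivative (h s - \<i> * of_real y * f s)) (at s within X)" for s X
  proof -
    have "((\<lambda>s. ?\<phi> s) has_real_derivative (- s * ?\<phi> s)) (at s within X)"
    proof -
      have "((\<lambda>s. exp (- s\<^sup>2 / 2)) has_real_derivative (- s * exp (- s\<^sup>2 / 2))) (at s within X)"
        by (auto intro!: derivative_eq_intros)
      from DERIV_cmult[OF this, of "1 / sqrt (2 * pi)"] show ?thesis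
        unfolding std_normal_density_def by (simp add: field_simps)
    qed
    then have 1: "((\<lambda>s. complex_of_real (?\<phi> s)) has_vector_derivative of_real (- s * ?\<phi> s)) (at s within X)"
      by (rule has_vector_derivative_of_real)
    have 2: "((\<lambda>s. iexp (- (y * s))) has_vector_derivative (- \<i> * of_real y * iexp (- (y * s)))) (at s within X)"
    proof -
      have "((\<lambda>s. (\<lambda>w. exp (- \<i> * of_real y * w)) (of_real s)) has_vector_derivative
          (- \<i> * of_real y * exp (- \<i> * of_real y * of_real s))) (at s within X)"
        by (rule has_vector_derivative_real_field) (auto intro!: derivative_eq_intros)
      then show ?thesis by (simp add: mult.assoc)
    qed
    show ?thesis
      using has_vector_derivative_mult[OF 1 2]
      by (simp add: f_def h_def algebra_simps)
  qed
  have cont: "continuous_on X (\<lambda>s. h s - \<i> * of_real y * f s)" for X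
    unfolding h_def f_def std_normal_density_def by (intro continuous_intros) auto
  let ?g = "\<lambda>s. h s - \<i> * of_real y * f s"
  have g_int: "set_integrable lborel A ?g" if "A \<in> sets borel" for A
    unfolding set_integrable_def using that f_int h_int
    by (intro integrable_mult_indicator) auto
  \<comment> \<open>The bound is uniform in \<open>a\<close>, so it survives the passage to the
    whole half-line.\<close>
  have FTC: "norm (LINT s:{a..0}|lborel. ?g s) \<le> 2 * ?\<phi> 0" if "a \<le> 0" for a
  proof -
    have "(LINT s:{a..0}|lborel. ?g s) = f 0 - f a"
      unfolding set_lebesgue_integral_def
      by (intro integral_FTC_atLeastAtMost that deriv cont)
    moreover have "norm (f s) \<le> ?\<phi> 0" for s
    proof -
      have "norm (f s) = ?\<phi> s" by (simp add: f_def norm_mult)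
      also have "\<dots> \<le> ?\<phi> 0" by (simp add: std_normal_density_def divide_right_mono)
      finally show ?thesis .
    qed
    ultimately show ?thesis
      using norm_triangle_ineq4[of "f 0" "f a"] by (smt (verit))
  qed
  have "((\<lambda>a. LINT s:{a..0}|lborel. ?g s) \<longlongrightarrow> (LINT s:{..0}|lborel. ?g s)) at_bot"
    by (intro tendsto_set_lebesgue_integral_at_bot g_int) auto
  then have lim: "norm (LINT s:{..0}|lborel. ?g s) \<le> 2 * ?\<phi> 0"
    by (rule Lim_norm_ubound[rotated])
       (use eventually_mono[OF eventually_le_at_bot[of "0::real"] FTC] in auto)
  have "(LINT s:{..0}|lborel. ?g s) = (LINT s:{..0}|lborel. h s) - \<i> * of_real y * half_char y"
  proof -
    have "set_integrable lborel {..0} h" "set_integrable lborel {..0} f"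
      unfolding set_integrable_def using f_int h_int by (auto intro!: integrable_mult_indicator)
    then have "(LINT s:{..0}|lborel. ?g s) =
        (LINT s:{..0}|lborel. h s) - (LINT s:{..0}|lborel. \<i> * of_real y * f s)"
      by (intro set_integral_diff(2) set_integrable_mult_right)
    then show ?thesis
      by (simp add: set_integral_mult_right half_char_def f_def)
  qed
  then have "\<i> * of_real y * half_char y = (LINT s:{..0}|lborel. h s) - (LINT s:{..0}|lborel. ?g s)"
    by simp
  from arg_cong[OF this, of norm]
  have "\<bar>y\<bar> * norm (half_char y) = norm ((LINT s:{..0}|lborel. h s) - (LINT s:{..0}|lborel. ?g s))"
    by (simp add: norm_mult)
  also have "\<dots> \<le> norm (LINT s:{..0}|lborel. h s) + 2 * ?\<phi> 0"
    using lim norm_triangle_ineq4[of "LINT s:{..0}|lborel. h s" "LINT s:{..0}|lborel. ?g s"] by linarith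
  also have "norm (LINT s:{..0}|lborel. h s) \<le> (LINT s|lborel. norm (indicator {..0} s *\<^sub>R h s))"
    unfolding set_lebesgue_integral_def by (rule integral_norm_bound)
  also have "\<dots> \<le> ?A"
    by (rule integral_mono'[OF intA]) (auto simp: h_def f_def norm_mult indicator_def)
  finally show "\<bar>y\<bar> * norm (half_char y) \<le> 2 * ?\<phi> 0 + ?A + 1" by simp
qed

section \<open>The standard Gaussian measure\<close>

lemma integral_lborel_prod:
  fixes f :: "'a::euclidean_space \<Rightarrow> real \<Rightarrow> 'b::{real_normed_field,banach,second_countable_topology}"
  assumes "\<And>b. b \<in> Basis \<Longrightarrow> integrable lborel (f b)"
  shows "(LINT x|lborel. (\<Prod>b\<in>Basis. f b (x \<bullet> b))) = (\<Prod>b\<in>Basis. LINT x|lborel. f b x)"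
proof -
  interpret product_sigma_finite "\<lambda>_::'a. lborel::real measure" ..
  have [measurable]: "f b \<in> borel_measurable borel" if "b \<in> Basis" for b
    using borel_measurable_integrable[OF assms[OF that]] by simp
  have "(LINT x|lborel. (\<Prod>b\<in>Basis. f b (x \<bullet> b))) =
      (LINT x|(\<Pi>\<^sub>M b\<in>Basis. lborel). (\<Prod>b\<in>Basis. f b ((\<Sum>b\<in>Basis. x b *\<^sub>R b) \<bullet> b)))"
    by (subst lborel_eq, subst integral_distr) (auto intro!: borel_measurable_prod)
  also have "\<dots> = (LINT x|(\<Pi>\<^sub>M b\<in>Basis. lborel). (\<Prod>b\<in>Basis. f b (x b)))"
    by (intro Bochner_Integration.integral_cong prod.cong) (auto simp: inner_sum_left_Basis)
  also have "\<dots> = (\<Prod>b\<in>Basis. LINT x|lborel. f b x)"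
    by (rule product_integral_prod) (use assms in auto)
  finally show ?thesis .
qed

lemma prod_Basis_vec:
  "(\<Prod>b\<in>(Basis :: (real ^ 'n) set). h b) = (\<Prod>j\<in>UNIV. h (axis j 1))"
proof -
  have B: "(Basis :: (real ^ 'n) set) = range (\<lambda>j. axis j 1)"
    by (auto simp: Basis_vec_def)
  have inj: "inj (\<lambda>j::'n. axis j (1::real))"
    by (simp add: inj_on_def axis_eq_axis)
  show ?thesis
    unfolding B using prod.reindex[OF inj, of h] by (simp add: o_def)
qed

lemma integral_lborel_vec_prod:
  fixes f :: "'n::finite \<Rightarrow> real \<Rightarrow> 'b::{real_normed_field,banach,second_countable_topology}"
  assumes "\<And>j. integrable lborel (f j)"
  shows "(LINT x|lborel. (\<Prod>j\<in>UNIV. f j (x $ j))) = (\<Prod>j\<in>UNIV. LINT x|lborel. f j x)"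
proof -
  \<comment> \<open>The product formula is indexed by \<open>Basis\<close>; the description operator
    recovers the coordinate of a basis vector \<open>axis j 1\<close>.\<close>
  let ?h = "\<lambda>b::real^'n. f (THE j. b = axis j 1)"
  have h: "?h (axis j 1) = f j" for j
    by (simp add: axis_eq_axis)
  have "(LINT x|lborel. (\<Prod>b\<in>Basis. ?h b (x \<bullet> b))) = (\<Prod>b\<in>Basis. LINT x|lborel. ?h b x)"
    by (rule integral_lborel_prod) (auto simp: Basis_vec_def h assms)
  then show ?thesis
    unfolding prod_Basis_vec h by (simp add: inner_axis)
qed

lemma nn_integral_lborel_vec_prod:
  fixes f :: "'n::finite \<Rightarrow> real \<Rightarrow> ennreal"
  assumes "\<And>j. f j \<in> borel_measurable borel"
  shows "(\<integral>\<^sup>+x. (\<Prod>j\<in>UNIV. f j (x $ j)) \<partial>lborel) = (\<Prod>j\<in>UNIV. \<integral>\<^sup>+x. f j x \<partial>lborel)"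
proof -
  let ?h = "\<lambda>b::real^'n. f (THE j. b = axis j 1)"
  have h: "?h (axis j 1) = f j" for j
    by (simp add: axis_eq_axis)
  have "(\<integral>\<^sup>+x. (\<Prod>b\<in>Basis. ?h b (x \<bullet> b)) \<partial>lborel) = (\<Prod>b\<in>Basis. \<integral>\<^sup>+x. ?h b x \<partial>lborel)"
    by (rule nn_integral_lborel_prod) (auto simp: Basis_vec_def h assms)
  then show ?thesis
    unfolding prod_Basis_vec h by (simp add: inner_axis)
qed

definition gaussian_density :: "real ^ 'n::finite \<Rightarrow> real" where
  "gaussian_density x = (\<Prod>j\<in>UNIV. std_normal_density (x $ j))"

lemma std_gaussian_eq: "std_gaussian = density lborel gaussian_density"
  by (simp add: std_gaussian_def gaussian_density_def)

lemma gaussian_density_nonneg [simp]: "0 \<le> gaussian_density x"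
  by (simp add: gaussian_density_def prod_nonneg)

lemma borel_measurable_gaussian_density [measurable]: "gaussian_density \<in> borel_measurable borel"
  unfolding gaussian_density_def[abs_def] by measurable

lemma gaussian_density_eq:
  "gaussian_density (x :: real ^ 'n::finite) = (1 / sqrt (2 * pi)) ^ CARD('n) * exp (- (x \<bullet> x) / 2)"
  by (simp add: gaussian_density_def std_normal_density_def prod.distrib exp_sum[symmetric] inner_vec_def
      sum_negf sum_divide_distrib power2_eq_square prod_dividef power_one_over)

lemma sets_std_gaussian [simp, measurable_cong]: "sets std_gaussian = sets borel"
  and space_std_gaussian [simp]: "space std_gaussian = UNIV"
  by (simp_all add: std_gaussian_def)

lemma prob_space_std_normal_distribution: "prob_space std_normal_distribution"
  by (rule prob_space_normal_density) simp

lemma prob_space_std_gaussian: "prob_space (std_gaussian :: (real ^ 'n::finite) measure)"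
proof
  have "(\<integral>\<^sup>+x. ennreal (std_normal_density x) \<partial>lborel) = 1"
    using prob_space.emeasure_space_1[OF prob_space_std_normal_distribution]
    by (simp add: emeasure_density)
  then show "emeasure (std_gaussian :: (real ^ 'n) measure) (space std_gaussian) = 1"
    using nn_integral_lborel_vec_prod[of "\<lambda>(_::'n) x. ennreal (std_normal_density x)"]
    by (simp add: std_gaussian_def emeasure_density flip: prod_ennreal)
qed

lemma AE_std_gaussian:
  assumes "AE x in lborel. Q x" shows "AE x in std_gaussian. Q x"
  unfolding std_gaussian_eq using assms by (subst AE_density) auto

lemma integral_std_gaussian_prod:
  fixes f :: "'n::finite \<Rightarrow> real \<Rightarrow> complex"
  assumes [measurable]: "\<And>j. f j \<in> borel_measurable borel" and bd: "\<And>j x. norm (f j x) \<le> B"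
  shows "(LINT x|std_gaussian. (\<Prod>j\<in>UNIV. f j (x $ j))) =
    (\<Prod>j\<in>UNIV. LINT x|std_normal_distribution. f j x)"
proof -
  have int: "integrable lborel (\<lambda>x. std_normal_density x *\<^sub>R f j x)" for j
  proof (rule Bochner_Integration.integrable_bound)
    show "integrable lborel (\<lambda>x. std_normal_density x * B)"
      by (intro integrable_mult_left integrable_normal_density) simp
    show "AE x in lborel. norm (std_normal_density x *\<^sub>R f j x) \<le> norm (std_normal_density x * B)"
      using order_trans[OF bd[of j] abs_ge_self] by (auto intro!: AE_I2 mult_left_mono simp: abs_mult)
  qed simp
  have "(LINT x|std_gaussian. (\<Prod>j\<in>UNIV. f j (x $ j))) =
      (LINT x|lborel. (\<Prod>j\<in>UNIV. std_normal_density (x $ j) *\<^sub>R f j (x $ j)))"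
    unfolding std_gaussian_eq
    by (subst integral_density)
       (auto simp: gaussian_density_def scaleR_conv_of_real prod.distrib intro!: prod_nonneg)
  also have "\<dots> = (\<Prod>j\<in>UNIV. LINT x|lborel. std_normal_density x *\<^sub>R f j x)"
    by (rule integral_lborel_vec_prod) (rule int)
  finally show ?thesis
    by (simp add: integral_density)
qed

section \<open>Replacing one component of a Gaussian vector by an independent normal\<close>

lemma nn_integral_lborel_shift:
  fixes f :: "'a::euclidean_space \<Rightarrow> ennreal"
  assumes [measurable]: "f \<in> borel_measurable borel"
  shows "(\<integral>\<^sup>+x. f (x + c) \<partial>lborel) = (\<integral>\<^sup>+x. f x \<partial>lborel)"
proof -
  have "(\<integral>\<^sup>+x. f x \<partial>lborel) = (\<integral>\<^sup>+x. f x \<partial>(distr lborel borel ((+) c)))"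
    by (simp add: lborel_distr_plus)
  also have "\<dots> = (\<integral>\<^sup>+x. f (x + c) \<partial>lborel)"
    by (subst nn_integral_distr) (auto simp: add.commute)
  finally show ?thesis ..
qed

lemma nn_integral_std_normal_density_reflect:
  "(\<integral>\<^sup>+t. ennreal (std_normal_density (a - t)) \<partial>lborel) = 1"
proof -
  have "(\<integral>\<^sup>+x. ennreal (std_normal_density x) \<partial>lborel) = 1"
    using prob_space.emeasure_space_1[OF prob_space_std_normal_distribution]
    by (simp add: emeasure_density)
  then show ?thesis
    by (subst (asm) nn_integral_real_affine[of _ "-1" a]) auto
qed

text \<open>
  Only translations are needed: after multiplying by the density, both sides differ by the weight
  \<open>std_normal_density (x \<bullet> u - t)\<close>, which integrates to one over \<open>t\<close>.
\<close>

lemma nn_integral_std_gaussian_resample: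
  fixes u :: "real ^ 'n::finite"
  assumes u: "u \<bullet> u = 1" and [measurable]: "f \<in> borel_measurable borel"
  shows "(\<integral>\<^sup>+x. \<integral>\<^sup>+w. f (x - (x \<bullet> u) *\<^sub>R u + w *\<^sub>R u) \<partial>std_normal_distribution \<partial>std_gaussian) =
    (\<integral>\<^sup>+x. f x \<partial>std_gaussian)"
proof -
  let ?\<phi> = "std_normal_density"
  interpret N: prob_space std_normal_distribution by (rule prob_space_std_normal_distribution)
  have [measurable]: "(\<lambda>x. \<integral>\<^sup>+w. f (x - (x \<bullet> u) *\<^sub>R u + w *\<^sub>R u) \<partial>std_normal_distribution) \<in> borel_measurable lborel"
    by (rule N.borel_measurable_nn_integral) simp
  define G where "G x = ennreal (gaussian_density x) * f x" for x
  have [measurable]: "G \<in> borel_measurable borel"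
    unfolding G_def[abs_def] by measurable
  \<comment> \<open>By Pythagoras, exchanging the component \<open>x \<bullet> u\<close> for
    \<open>w\<close> changes the squared norm by w^2 - (x . u)^2, so the joint density is symmetric
    under this exchange.\<close>
  have key: "gaussian_density x * ?\<phi> w = gaussian_density (x - (x \<bullet> u) *\<^sub>R u + w *\<^sub>R u) * ?\<phi> (x \<bullet> u)" for x w
  proof -
    have "(x - (x \<bullet> u) *\<^sub>R u + w *\<^sub>R u) \<bullet> (x - (x \<bullet> u) *\<^sub>R u + w *\<^sub>R u) = x \<bullet> x - (x \<bullet> u)\<^sup>2 + w\<^sup>2"
      using u by (simp add: inner_add_left inner_add_right inner_diff_left inner_diff_right
          inner_commute power2_eq_square algebra_simps)
    moreover have "exp (- (x \<bullet> x) / 2) * exp (- w\<^sup>2 / 2) =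
        exp (- (x \<bullet> x - (x \<bullet> u)\<^sup>2 + w\<^sup>2) / 2) * exp (- (x \<bullet> u)\<^sup>2 / 2)"
      by (simp add: exp_add[symmetric] field_simps)
    ultimately show ?thesis
      by (simp add: gaussian_density_eq std_normal_density_def)
  qed
  have "(\<integral>\<^sup>+x. \<integral>\<^sup>+w. f (x - (x \<bullet> u) *\<^sub>R u + w *\<^sub>R u) \<partial>std_normal_distribution \<partial>std_gaussian) =
      (\<integral>\<^sup>+x. \<integral>\<^sup>+w. ennreal (gaussian_density x * ?\<phi> w) * f (x - (x \<bullet> u) *\<^sub>R u + w *\<^sub>R u) \<partial>lborel \<partial>lborel)"
    unfolding std_gaussian_eq
    by (subst nn_integral_density, measurable, intro nn_integral_cong, subst nn_integral_density,
        measurable, subst nn_integral_cmult[symmetric])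
       (auto simp: ennreal_mult mult.assoc)
  also have "\<dots> = (\<integral>\<^sup>+x. \<integral>\<^sup>+w. G (x - (x \<bullet> u) *\<^sub>R u + w *\<^sub>R u) * ennreal (?\<phi> (x \<bullet> u)) \<partial>lborel \<partial>lborel)"
    by (intro nn_integral_cong) (subst key, simp add: G_def ennreal_mult mult_ac)
  also have "\<dots> = (\<integral>\<^sup>+x. \<integral>\<^sup>+t. G (x + t *\<^sub>R u) * ennreal (?\<phi> (x \<bullet> u)) \<partial>lborel \<partial>lborel)"
  proof (rule nn_integral_cong)
    fix x
    show "(\<integral>\<^sup>+w. G (x - (x \<bullet> u) *\<^sub>R u + w *\<^sub>R u) * ennreal (?\<phi> (x \<bullet> u)) \<partial>lborel) =
        (\<integral>\<^sup>+t. G (x + t *\<^sub>R u) * ennreal (?\<phi> (x \<bullet> u)) \<partial>lborel)"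
      by (subst nn_integral_lborel_shift[of _ "x \<bullet> u", symmetric]) (auto simp: algebra_simps)
  qed
  also have "\<dots> = (\<integral>\<^sup>+t. \<integral>\<^sup>+x. G (x + t *\<^sub>R u) * ennreal (?\<phi> (x \<bullet> u)) \<partial>lborel \<partial>lborel)"
    by (rule pair_sigma_finite.Fubini'[symmetric])
       (auto intro!: pair_sigma_finite.intro sigma_finite_lborel)
  \<comment> \<open>With \<open>t\<close> now fixed, the integral over \<open>x\<close> may be
    shifted by \<open>t *\<^sub>R u\<close>; as \<open>u\<close> is a unit vector, this changes
    \<open>x \<bullet> u\<close> by exactly \<open>t\<close>.\<close>
  also have "\<dots> = (\<integral>\<^sup>+t. \<integral>\<^sup>+x. G x * ennreal (?\<phi> (x \<bullet> u - t)) \<partial>lborel \<partial>lborel)"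
  proof (rule nn_integral_cong)
    fix t :: real
    show "(\<integral>\<^sup>+x. G (x + t *\<^sub>R u) * ennreal (?\<phi> (x \<bullet> u)) \<partial>lborel) =
        (\<integral>\<^sup>+x. G x * ennreal (?\<phi> (x \<bullet> u - t)) \<partial>lborel)"
      by (subst (2) nn_integral_lborel_shift[of _ "t *\<^sub>R u", symmetric])
         (auto simp: inner_add_left u)
  qed
  also have "\<dots> = (\<integral>\<^sup>+x. \<integral>\<^sup>+t. G x * ennreal (?\<phi> (x \<bullet> u - t)) \<partial>lborel \<partial>lborel)"
    by (rule pair_sigma_finite.Fubini')
       (auto intro!: pair_sigma_finite.intro sigma_finite_lborel)
  also have "\<dots> = (\<integral>\<^sup>+x. G x \<partial>lborel)"
    by (subst nn_integral_cmult) (auto simp: nn_integral_std_normal_density_reflect)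
  also have "\<dots> = (\<integral>\<^sup>+x. f x \<partial>std_gaussian)"
    unfolding std_gaussian_eq G_def by (subst nn_integral_density) auto
  finally show ?thesis .
qed

text \<open>This is how the independence of \<open>x \<bullet> u\<close> and the residual is used:
  as an identity of laws it applies to Bochner integrals and makes the component along
  \<open>u\<close> a separate variable \<open>w\<close>.\<close>

lemma distr_std_gaussian_resample:
  fixes u :: "real ^ 'n::finite"
  assumes u: "u \<bullet> u = 1"
  shows "distr (std_gaussian \<Otimes>\<^sub>M std_normal_distribution) borel
      (\<lambda>(x, w). x - (x \<bullet> u) *\<^sub>R u + w *\<^sub>R u) = std_gaussian"
proof (rule measure_eqI)
  interpret N: prob_space std_normal_distribution by (rule prob_space_std_normal_distribution)
  fix A assume "A \<in> sets (distr (std_gaussian \<Otimes>\<^sub>M std_normal_distribution) borel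
      (\<lambda>(x, w). x - (x \<bullet> u) *\<^sub>R u + w *\<^sub>R u))"
  then have A [measurable]: "A \<in> sets borel" by simp
  have "emeasure (distr (std_gaussian \<Otimes>\<^sub>M std_normal_distribution) borel
      (\<lambda>(x, w). x - (x \<bullet> u) *\<^sub>R u + w *\<^sub>R u)) A =
    (\<integral>\<^sup>+x. indicator A x \<partial>distr (std_gaussian \<Otimes>\<^sub>M std_normal_distribution) borel
      (\<lambda>(x, w). x - (x \<bullet> u) *\<^sub>R u + w *\<^sub>R u))"
    by simp
  also have "\<dots> = (\<integral>\<^sup>+z. indicator A ((\<lambda>(x, w). x - (x \<bullet> u) *\<^sub>R u + w *\<^sub>R u) z)
      \<partial>(std_gaussian \<Otimes>\<^sub>M std_normal_distribution))"
    by (rule nn_integral_distr) measurable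
  also have "\<dots> = (\<integral>\<^sup>+x. \<integral>\<^sup>+w. indicator A (x - (x \<bullet> u) *\<^sub>R u + w *\<^sub>R u)
      \<partial>std_normal_distribution \<partial>std_gaussian)"
    by (subst N.nn_integral_fst[symmetric]) auto
  also have "\<dots> = emeasure std_gaussian A"
    by (subst nn_integral_std_gaussian_resample[OF u]) auto
  finally show "emeasure (distr (std_gaussian \<Otimes>\<^sub>M std_normal_distribution) borel
      (\<lambda>(x, w). x - (x \<bullet> u) *\<^sub>R u + w *\<^sub>R u)) A = emeasure std_gaussian A" .
qed simp

section \<open>Fourier inversion for the measure of a cell\<close>

text \<open>The regularizing pair: c times this density tends to the constant 1 / sqrt (2 pi) as c
  grows, while c times its transform concentrates at t = 0.\<close>

lemma integral_normal_iexp: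
  assumes "c > 0"
  shows "(LINT y|lborel. of_real (normal_density 0 c y) * iexp (y * t)) = of_real (exp (- (c * t)\<^sup>2 / 2))"
proof -
  have nd: "c * normal_density 0 c (c * y) = std_normal_density y" for y
    using assms by (simp add: normal_density_def real_sqrt_mult field_simps power2_eq_square)
  have "(LINT y|lborel. of_real (normal_density 0 c y) * iexp (y * t)) =
      c *\<^sub>R (LINT y|lborel. of_real (normal_density 0 c (c * y)) * iexp (c * y * t))"
    using assms by (subst lborel_integral_real_affine[of c _ 0]) auto
  also have "\<dots> = (LINT y|lborel. c *\<^sub>R (of_real (normal_density 0 c (c * y)) * iexp (c * y * t)))"
    by simp
  also have "\<dots> = (LINT y|lborel. std_normal_density y *\<^sub>R iexp ((c * t) * y))"
    by (rule Bochner_Integration.integral_cong)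
       (auto simp: nd[symmetric] scaleR_conv_of_real mult_ac)
  also have "\<dots> = char std_normal_distribution (c * t)"
    unfolding char_def by (subst integral_density) auto
  finally show ?thesis
    by (simp add: char_std_normal_distribution)
qed

text \<open>Zero extension turns sums over \<open>S\<close> into inner products of the ambient
  space, so resampling applies with the restricted vector as direction.\<close>

definition restrict_vec :: "'n set \<Rightarrow> real ^ 'n \<Rightarrow> real ^ 'n" where
  "restrict_vec S u = (\<chi> j. if j \<in> S then u $ j else 0)"

lemma restrict_vec_nth [simp]: "restrict_vec S u $ j = (if j \<in> S then u $ j else 0)"
  by (simp add: restrict_vec_def)

lemma inner_restrict_vec: "x \<bullet> restrict_vec S (u :: real ^ 'n::finite) = (\<Sum>j\<in>S. x $ j * u $ j)"
  unfolding inner_vec_def by (auto intro!: sum.mono_neutral_cong_right)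

text \<open>The exponential of an inner product splits over the coordinates, so their independence
  turns the expectation into a product. The constants \<open>b j\<close> stand for the thresholds
  that arise once W is fixed.\<close>

lemma integral_std_gaussian_quadrant_iexp:
  fixes u :: "real ^ 'n::finite"
  shows "(LINT x|std_gaussian. indicator {x. (\<forall>j\<in>S. x $ j \<le> 0) \<and> (\<forall>j\<in>-S. b j < x $ j)} x *\<^sub>R
        iexp (- (y * (x \<bullet> restrict_vec S u)))) =
    (\<Prod>j\<in>S. half_char (y * u $ j)) * (\<Prod>j\<in>-S. of_real (measure std_normal_distribution {b j<..}))"
proof -
  interpret N: prob_space std_normal_distribution by (rule prob_space_std_normal_distribution)
  define f where "f j s = (if j \<in> S then of_real (indicator {..0} s) * iexp (- (y * u $ j * s))
      else complex_of_real (indicator {b j<..} s))" for j s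
  have f1: "(LINT s|std_normal_distribution. f j s) = half_char (y * u $ j)" if "j \<in> S" for j
    using that unfolding f_def half_char_def set_lebesgue_integral_def
    by (subst integral_density) (auto intro!: Bochner_Integration.integral_cong simp: scaleR_conv_of_real mult_ac)
  have f2: "(LINT s|std_normal_distribution. f j s) = of_real (measure std_normal_distribution {b j<..})"
    if "j \<in> -S" for j
  proof -
    have "(LINT s|std_normal_distribution. f j s) = of_real (LINT s|std_normal_distribution. indicator {b j<..} s)"
      using that unfolding f_def by (simp add: integral_complex_of_real[symmetric] del: integral_indicator)
    then show ?thesis by simp
  qed
  have "(LINT x|std_gaussian. (\<Prod>j\<in>UNIV. f j (x $ j))) = (\<Prod>j\<in>UNIV. LINT s|std_normal_distribution. f j s)"
    by (rule integral_std_gaussian_prod[where B=1])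
       (auto simp: f_def norm_mult indicator_def)
  also have "\<dots> = (\<Prod>j\<in>S. LINT s|std_normal_distribution. f j s) * (\<Prod>j\<in>-S. LINT s|std_normal_distribution. f j s)"
    by (subst prod.union_disjoint[symmetric]) auto
  also have "(LINT x|std_gaussian. (\<Prod>j\<in>UNIV. f j (x $ j))) =
     (LINT x|std_gaussian. indicator {x. (\<forall>j\<in>S. x $ j \<le> 0) \<and> (\<forall>j\<in>-S. b j < x $ j)} x *\<^sub>R
        iexp (- (y * (x \<bullet> restrict_vec S u))))"
  proof (rule Bochner_Integration.integral_cong[OF refl])
    fix x :: "real ^ 'n"
    have ind: "(\<Prod>j\<in>A. complex_of_real (indicator (B j) (x $ j))) = of_real (indicator {x. \<forall>j\<in>A. x $ j \<in> B j} x)" for A B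
    proof (cases "\<forall>j\<in>A. x $ j \<in> B j")
      case False
      then obtain j where "j \<in> A" "x $ j \<notin> B j" by blast
      with False show ?thesis by (auto intro!: prod_zero bexI[of _ j])
    qed auto
    have "(\<Prod>j\<in>UNIV. f j (x $ j)) = (\<Prod>j\<in>S. f j (x $ j)) * (\<Prod>j\<in>-S. f j (x $ j))"
      by (subst prod.union_disjoint[symmetric]) auto
    also have "\<dots> = (\<Prod>j\<in>S. of_real (indicator {..0} (x $ j))) * (\<Prod>j\<in>S. iexp (- (y * u $ j * x $ j))) *
        (\<Prod>j\<in>-S. of_real (indicator {b j<..} (x $ j)))"
      unfolding f_def by (simp add: prod.distrib)
    also have "(\<Prod>j\<in>S. iexp (- (y * u $ j * x $ j))) = iexp (- (y * (x \<bullet> restrict_vec S u)))"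
      by (simp add: exp_sum[symmetric] inner_restrict_vec sum_distrib_left sum_negf mult_ac)
    finally show "(\<Prod>j\<in>UNIV. f j (x $ j)) =
        indicator {x. (\<forall>j\<in>S. x $ j \<le> 0) \<and> (\<forall>j\<in>-S. b j < x $ j)} x *\<^sub>R iexp (- (y * (x \<bullet> restrict_vec S u)))"
      unfolding ind by (auto simp: indicator_def)
  qed
  finally show ?thesis
    by (simp add: f1 f2)
qed

text \<open>The weight is c times a probability density and the oscillating integrand is bounded, so
  Fubini applies. Integrating over y first produces the kernel on the right.\<close>

lemma integral_half_char_prod_regularized:
  fixes u :: "real ^ 'n::finite" and S :: "'n set" and b :: "'n \<Rightarrow> real" and c :: real
  defines "B \<equiv> {x. (\<forall>j\<in>S. x $ j \<le> 0) \<and> (\<forall>j\<in>-S. b j < x $ j)}"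
  assumes c: "c > 0"
  shows "(LINT y|lborel. of_real (exp (- (y / c)\<^sup>2 / 2) / sqrt (2 * pi)) * (\<Prod>j\<in>S. half_char (y * u $ j))) *
      (\<Prod>j\<in>-S. of_real (measure std_normal_distribution {b j<..})) =
    of_real (LINT x|std_gaussian. indicator B x * (c * exp (- (c * (x \<bullet> restrict_vec S u))\<^sup>2 / 2)))"
proof -
  interpret G: prob_space "std_gaussian :: (real ^ 'n) measure" by (rule prob_space_std_gaussian)
  interpret N: prob_space "density lborel (normal_density 0 c)" by (rule prob_space_normal_density[OF c])
  interpret P: pair_prob_space "density lborel (normal_density 0 c)" "std_gaussian :: (real ^ 'n) measure" ..
  let ?m = "\<Prod>j\<in>-S. complex_of_real (measure std_normal_distribution {b j<..})"
  have B [measurable]: "B \<in> sets borel"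
    unfolding B_def by measurable
  have nd: "c * normal_density 0 c y = exp (- (y / c)\<^sup>2 / 2) / sqrt (2 * pi)" for y
    using c by (simp add: normal_density_def real_sqrt_mult field_simps)
  have "(LINT y|lborel. of_real (exp (- (y / c)\<^sup>2 / 2) / sqrt (2 * pi)) * (\<Prod>j\<in>S. half_char (y * u $ j))) * ?m =
    of_real c * (LINT y|lborel. normal_density 0 c y *\<^sub>R ((\<Prod>j\<in>S. half_char (y * u $ j)) * ?m))"
    unfolding nd[symmetric]
    by (simp add: integral_mult_right_zero[symmetric] integral_mult_left_zero[symmetric] scaleR_conv_of_real mult_ac
        del: integral_mult_right_zero integral_mult_left_zero)
  also have "(LINT y|lborel. normal_density 0 c y *\<^sub>R ((\<Prod>j\<in>S. half_char (y * u $ j)) * ?m)) =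
      (LINT y|density lborel (normal_density 0 c). LINT x|std_gaussian. indicator B x *\<^sub>R iexp (- (y * (x \<bullet> restrict_vec S u))))"
    unfolding integral_std_gaussian_quadrant_iexp[of S b, folded B_def]
    by (subst integral_density) (auto simp: normal_density_nonneg)
  also have "\<dots> = (LINT x|std_gaussian. LINT y|density lborel (normal_density 0 c). indicator B x *\<^sub>R iexp (- (y * (x \<bullet> restrict_vec S u))))"
    by (rule P.Fubini_integral[symmetric], rule P.P.integrable_const_bound[where B=1])
       (auto simp: indicator_def)
  also have "\<dots> = (LINT x|std_gaussian. of_real (indicator B x * exp (- (c * (x \<bullet> restrict_vec S u))\<^sup>2 / 2)))"
  proof (rule Bochner_Integration.integral_cong[OF refl])
    fix x :: "real ^ 'n"
    have "(LINT y|density lborel (normal_density 0 c). iexp (- (y * (x \<bullet> restrict_vec S u)))) =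
        of_real (exp (- (c * (x \<bullet> restrict_vec S u))\<^sup>2 / 2))"
      using integral_normal_iexp[OF c, of "- (x \<bullet> restrict_vec S u)"]
      by (subst integral_density) (auto simp: normal_density_nonneg scaleR_conv_of_real)
    then show "(LINT y|density lborel (normal_density 0 c). indicator B x *\<^sub>R iexp (- (y * (x \<bullet> restrict_vec S u)))) =
        of_real (indicator B x * exp (- (c * (x \<bullet> restrict_vec S u))\<^sup>2 / 2))"
      by (simp add: scaleR_conv_of_real)
  qed
  also have "of_real c * \<dots> = of_real (LINT x|std_gaussian. indicator B x * (c * exp (- (c * (x \<bullet> restrict_vec S u))\<^sup>2 / 2)))"
    by (simp only: integral_complex_of_real of_real_mult[symmetric] integral_mult_right_zero[symmetric] mult_ac)
  finally show ?thesis .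
qed

text \<open>Resampling makes the component along \<open>u\<close> an independent variable w, and the
  substitution w = t / c absorbs the factor c. The integrand is then bounded by 1 for every
  c.\<close>

lemma integral_std_gaussian_concentrate:
  fixes u :: "real ^ 'n::finite"
  assumes u: "u \<bullet> u = 1" and c: "c > 0" and B [measurable]: "B \<in> sets borel"
  shows "(LINT x|std_gaussian. indicator B x * (c * exp (- (c * (x \<bullet> u))\<^sup>2 / 2))) =
    (LINT x|std_gaussian. LINT t|std_normal_distribution.
        indicator B (x - (x \<bullet> u) *\<^sub>R u + (t / c) *\<^sub>R u) * exp (- (t / c)\<^sup>2 / 2))"
proof -
  interpret G: prob_space "std_gaussian :: (real ^ 'n) measure" by (rule prob_space_std_gaussian)
  interpret N: prob_space std_normal_distribution by (rule prob_space_std_normal_distribution)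
  interpret P: pair_prob_space "std_gaussian :: (real ^ 'n) measure" std_normal_distribution ..
  let ?Z = "\<lambda>x w. x - (x \<bullet> u) *\<^sub>R u + w *\<^sub>R u"
  have Zu: "?Z x w \<bullet> u = w" for x w
    using u by (simp add: inner_add_left inner_diff_left)
  have "(LINT x|std_gaussian. indicator B x * (c * exp (- (c * (x \<bullet> u))\<^sup>2 / 2))) =
    (LINT z|(std_gaussian \<Otimes>\<^sub>M std_normal_distribution).
      indicator B (?Z (fst z) (snd z)) * (c * exp (- (c * (?Z (fst z) (snd z) \<bullet> u))\<^sup>2 / 2)))"
    by (subst distr_std_gaussian_resample[OF u, symmetric], subst integral_distr)
       (auto simp: case_prod_beta)
  also have "\<dots> = (LINT z|(std_gaussian \<Otimes>\<^sub>M std_normal_distribution).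
      indicator B (?Z (fst z) (snd z)) * (c * exp (- (c * snd z)\<^sup>2 / 2)))"
    by (simp only: Zu)
  also have "\<dots> = (LINT x|std_gaussian. LINT w|std_normal_distribution. indicator B (?Z x w) * (c * exp (- (c * w)\<^sup>2 / 2)))"
    by (subst P.integral_fst'[symmetric], rule P.P.integrable_const_bound[where B=c])
       (use c in \<open>auto simp: indicator_def abs_mult\<close>)
  also have "\<dots> = (LINT x|std_gaussian. LINT t|std_normal_distribution.
        indicator B (?Z x (t / c)) * exp (- (t / c)\<^sup>2 / 2))"
  proof (rule Bochner_Integration.integral_cong[OF refl])
    fix x :: "real ^ 'n"
    \<comment> \<open>The two Gaussian factors trade places: the concentrating kernel becomes the
      density of t, and the old density leaves a factor tending to 1.\<close>
    have eq: "std_normal_density (t / c) * exp (- t\<^sup>2 / 2) = std_normal_density t * exp (- (t / c)\<^sup>2 / 2)" for t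
      by (simp add: std_normal_density_def)
    have "(LINT w|std_normal_distribution. indicator B (?Z x w) * (c * exp (- (c * w)\<^sup>2 / 2))) =
        (LINT w|lborel. std_normal_density w * (indicator B (?Z x w) * (c * exp (- (c * w)\<^sup>2 / 2))))"
      by (subst integral_density) auto
    also have "\<dots> = (LINT t|lborel. std_normal_density t * (indicator B (?Z x (t / c)) * exp (- (t / c)\<^sup>2 / 2)))"
    proof (subst lborel_integral_real_affine[of "1 / c" _ 0])
      have "\<bar>1 / c\<bar> *\<^sub>R (LINT t|lborel. std_normal_density (0 + 1 / c * t) *
          (indicator B (?Z x (0 + 1 / c * t)) * (c * exp (- (c * (0 + 1 / c * t))\<^sup>2 / 2)))) =
        (LINT t|lborel. (1 / c) * (std_normal_density (t / c) *
          (indicator B (?Z x (t / c)) * (c * exp (- t\<^sup>2 / 2)))))"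
        using c by (simp only: integral_mult_right_zero) simp
      also have "\<dots> = (LINT t|lborel. std_normal_density t * (indicator B (?Z x (t / c)) * exp (- (t / c)\<^sup>2 / 2)))"
      proof (rule Bochner_Integration.integral_cong[OF refl])
        fix t
        have "(1 / c) * (std_normal_density (t / c) * (indicator B (?Z x (t / c)) * (c * exp (- t\<^sup>2 / 2)))) =
            indicator B (?Z x (t / c)) * (std_normal_density (t / c) * exp (- t\<^sup>2 / 2))"
          using c by simp
        also have "\<dots> = std_normal_density t * (indicator B (?Z x (t / c)) * exp (- (t / c)\<^sup>2 / 2))"
          unfolding eq by (simp only: mult_ac)
        finally show "(1 / c) * (std_normal_density (t / c) * (indicator B (?Z x (t / c)) * (c * exp (- t\<^sup>2 / 2)))) =
            std_normal_density t * (indicator B (?Z x (t / c)) * exp (- (t / c)\<^sup>2 / 2))" .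
      qed
      finally show "\<bar>1 / c\<bar> *\<^sub>R (LINT t|lborel. std_normal_density (0 + 1 / c * t) *
          (indicator B (?Z x (0 + 1 / c * t)) * (c * exp (- (c * (0 + 1 / c * t))\<^sup>2 / 2)))) =
        (LINT t|lborel. std_normal_density t * (indicator B (?Z x (t / c)) * exp (- (t / c)\<^sup>2 / 2)))" .
    qed (use c in auto)
    also have "\<dots> = (LINT t|std_normal_distribution. indicator B (?Z x (t / c)) * exp (- (t / c)\<^sup>2 / 2))"
      by (subst integral_density) auto
    finally show "(LINT w|std_normal_distribution. indicator B (?Z x w) * (c * exp (- (c * w)\<^sup>2 / 2))) =
        (LINT t|std_normal_distribution. indicator B (?Z x (t / c)) * exp (- (t / c)\<^sup>2 / 2))" .
  qed
  finally show ?thesis .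
qed

section \<open>Null sets, integrability and the limit of the regularization\<close>

lemma AE_std_gaussian_inner_neq_0:
  assumes "a \<noteq> (0 :: real ^ 'n::finite)"
  shows "AE x in std_gaussian. a \<bullet> x \<noteq> 0"
proof (rule AE_std_gaussian)
  have "{x. a \<bullet> x = 0} \<in> null_sets lebesgue"
    using negligible_hyperplane[of a 0] assms by (simp add: negligible_iff_null_sets)
  then have "{x. a \<bullet> x = 0} \<in> null_sets lborel"
    by (subst (asm) null_sets_completion_iff) auto
  from AE_not_in[OF this] show "AE x in lborel. a \<bullet> x \<noteq> 0" by simp
qed

lemma abs_less_1_if_sum_squares_1:
  fixes u :: "'i \<Rightarrow> real"
  assumes "finite S" "(\<Sum>j\<in>S. (u j)\<^sup>2) = 1" "i \<in> S" "k \<in> S" "i \<noteq> k" "u k \<noteq> 0"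
  shows "(u i)\<^sup>2 < 1"
proof -
  have "(u i)\<^sup>2 + (u k)\<^sup>2 = (\<Sum>j\<in>{i, k}. (u j)\<^sup>2)"
    using assms by simp
  also have "\<dots> \<le> (\<Sum>j\<in>S. (u j)\<^sup>2)"
    using assms by (intro sum_mono2) auto
  finally show ?thesis
    using assms by (smt (verit) zero_less_power2)
qed

text \<open>Residual coordinate i is a linear functional of x whose i-th coefficient is 1 - u_i^2. A
  second index of \<open>S\<close> with a nonzero entry makes this positive, so the residual
  vanishes only on a hyperplane.\<close>

lemma AE_std_gaussian_residual_neq_0:
  fixes u :: "real ^ 'n::finite"
  assumes "(\<Sum>j\<in>S. (u $ j)\<^sup>2) = 1" "2 \<le> card S" "\<And>j. u $ j \<noteq> 0"
  shows "AE x in std_gaussian. \<forall>j\<in>S. x $ j \<noteq> (x \<bullet> restrict_vec S u) * u $ j"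
proof -
  have "AE x in std_gaussian. x $ i \<noteq> (x \<bullet> restrict_vec S u) * u $ i" if i: "i \<in> S" for i
  proof -
    have "\<not> S \<subseteq> {i}"
      using card_mono[of "{i}" S] assms(2) by auto
    then obtain k where k: "k \<in> S" "i \<noteq> k" by auto
    have "(u $ i)\<^sup>2 < 1"
      by (rule abs_less_1_if_sum_squares_1[of S "\<lambda>j. u $ j" i k]) (use assms i k in auto)
    then have "(axis i 1 - u $ i *\<^sub>R restrict_vec S u) $ i \<noteq> 0"
      using i by (simp add: axis_def power2_eq_square)
    then have "axis i 1 - u $ i *\<^sub>R restrict_vec S u \<noteq> 0" by (metis zero_index)
    moreover have "(axis i 1 - u $ i *\<^sub>R restrict_vec S u) \<bullet> x = x $ i - (x \<bullet> restrict_vec S u) * u $ i" for x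
      by (simp add: inner_diff_left inner_axis' inner_commute[of x])
    ultimately show ?thesis
      using AE_std_gaussian_inner_neq_0[of "axis i 1 - u $ i *\<^sub>R restrict_vec S u"] by simp
  qed
  then show ?thesis
    by (intro AE_finite_allI) auto
qed

lemma tendsto_inverse_Suc_mult: "(\<lambda>n. t / real (Suc n)) \<longlonglongrightarrow> 0"
  using tendsto_mult[OF tendsto_const[of t] LIMSEQ_inverse_real_of_nat] by (simp add: field_simps)

text \<open>The shift tends to 0 and \<open>y\<close> is off the walls over \<open>S\<close>, so the
  signs there stabilize; coordinates outside \<open>S\<close> are not moved at all.\<close>

lemma eventually_indicator_quadrant_eq:
  fixes u :: "real ^ 'n::finite" and S :: "'n set" and b :: "'n \<Rightarrow> real"
  defines "B \<equiv> {x. (\<forall>j\<in>S. x $ j \<le> 0) \<and> (\<forall>j\<in>-S. b j < x $ j)}"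
  assumes y: "\<forall>j\<in>S. y $ j \<noteq> 0"
  shows "\<forall>\<^sub>F n in sequentially. y + (t / real (Suc n)) *\<^sub>R restrict_vec S u \<in> B \<longleftrightarrow> y \<in> B"
proof -
  have "\<forall>\<^sub>F n in sequentially. (y + (t / real (Suc n)) *\<^sub>R restrict_vec S u) $ j \<le> 0 \<longleftrightarrow> y $ j \<le> 0" if j: "j \<in> S" for j
  proof -
    have "(\<lambda>n. y $ j + (t / real (Suc n)) * restrict_vec S u $ j) \<longlonglongrightarrow> y $ j + 0 * restrict_vec S u $ j"
      by (intro tendsto_intros tendsto_inverse_Suc_mult)
    then have lim: "(\<lambda>n. (y + (t / real (Suc n)) *\<^sub>R restrict_vec S u) $ j) \<longlonglongrightarrow> y $ j" by simp
    show ?thesis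
    proof (cases "y $ j < 0")
      case True
      from order_tendstoD(2)[OF lim this] show ?thesis
        by eventually_elim (use True in simp)
    next
      case False
      then have "y $ j > 0" using y j by force
      from order_tendstoD(1)[OF lim this] show ?thesis
        by eventually_elim (use \<open>y $ j > 0\<close> in simp)
    qed
  qed
  then have "\<forall>\<^sub>F n in sequentially. \<forall>j\<in>S. (y + (t / real (Suc n)) *\<^sub>R restrict_vec S u) $ j \<le> 0 \<longleftrightarrow> y $ j \<le> 0"
    by (simp add: eventually_ball_finite)
  then show ?thesis
    by eventually_elim (auto simp: B_def)
qed

text \<open>Two of the factors together decay like 1 / y^2; all the others are bounded by 1.\<close>

lemma integrable_half_char_prod:
  fixes u :: "'n \<Rightarrow> real"
  assumes "finite S" "2 \<le> card S" "\<And>j. u j \<noteq> 0"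
  shows "integrable lborel (\<lambda>y. \<Prod>j\<in>S. half_char (y * u j))"
proof -
  obtain C where C: "C > 0" "\<And>y. \<bar>y\<bar> * norm (half_char y) \<le> C"
    using norm_half_char_le_inverse by blast
  obtain i T where i: "i \<in> S" "S = insert i T" "i \<notin> T"
    using assms(2) by (metis Set.set_insert card.empty ex_in_conv not_numeral_le_zero)
  moreover obtain k where k: "k \<in> T"
    using assms(1,2) i by (cases "T = {}") auto
  define R where "R = T - {k}"
  have S: "S = insert i (insert k R)" "i \<notin> insert k R" "k \<notin> R" "finite R"
    using i k assms(1) by (auto simp: R_def)
  \<comment> \<open>In (1 + y^2) times the product of the two factors, 1 bounds the product itself
    and the second summand bounds y^2 times it.\<close>
  let ?D = "1 + C\<^sup>2 / \<bar>u i * u k\<bar>"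
  have bd: "norm (\<Prod>j\<in>S. half_char (y * u j)) \<le> ?D * inverse (1 + y\<^sup>2)" for y
  proof -
    let ?a = "norm (half_char (y * u i))" and ?b = "norm (half_char (y * u k))"
    have "norm (\<Prod>j\<in>R. half_char (y * u j)) \<le> 1"
      unfolding prod_norm[symmetric] by (intro prod_le_1) (auto simp: norm_half_char_le_1)
    then have "norm (\<Prod>j\<in>S. half_char (y * u j)) \<le> ?a * ?b"
      using S by (simp add: norm_mult mult.assoc[symmetric] mult_left_le)
    moreover have "(1 + y\<^sup>2) * (?a * ?b) \<le> ?D"
    proof -
      have "(\<bar>y * u i\<bar> * ?a) * (\<bar>y * u k\<bar> * ?b) \<le> C * C"
        using C by (intro mult_mono) auto
      then have "y\<^sup>2 * (?a * ?b) * \<bar>u i * u k\<bar> \<le> C\<^sup>2"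
        by (simp add: abs_mult power2_eq_square mult_ac)
      then have "y\<^sup>2 * (?a * ?b) \<le> C\<^sup>2 / \<bar>u i * u k\<bar>"
        using assms(3) by (simp add: pos_le_divide_eq)
      moreover have "?a * ?b \<le> 1"
        by (simp add: mult_le_one norm_half_char_le_1)
      ultimately show ?thesis by (simp add: algebra_simps)
    qed
    then have "?a * ?b \<le> ?D / (1 + y\<^sup>2)"
      by (subst pos_le_divide_eq) (auto simp: mult.commute add_pos_nonneg)
    ultimately show ?thesis by (simp add: divide_inverse)
  qed
  show ?thesis
  proof (rule Bochner_Integration.integrable_bound)
    show "integrable lborel (\<lambda>y::real. ?D * inverse (1 + y\<^sup>2))"
      using integrable_inverse_1_plus_square
      by (intro integrable_mult_right) (simp add: set_integrable_def einterval_def)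
    show "AE y in lborel. norm (\<Prod>j\<in>S. half_char (y * u j)) \<le> norm (?D * inverse (1 + y\<^sup>2))"
      using order_trans[OF bd abs_ge_self] by simp
  qed measurable
qed

text \<open>Take c = \<open>Suc n\<close> in the regularized identity and let n grow. On the
  Gaussian side the perturbed residual returns to \<open>Y x\<close>, on the Fourier side the weight
  tends to 1 / sqrt (2 pi); both limits are dominated.\<close>

lemma measure_std_gaussian_residual_quadrant_half_char:
  fixes u :: "real ^ 'n::finite" and S :: "'n set" and b :: "'n \<Rightarrow> real"
  assumes u: "(\<Sum>j\<in>S. (u $ j)\<^sup>2) = 1" and S: "2 \<le> card S" and nz: "\<And>j. u $ j \<noteq> 0"
  shows "of_real (measure std_gaussian
      {x. (\<forall>j\<in>S. x $ j < (x \<bullet> restrict_vec S u) * u $ j) \<and> (\<forall>j\<in>-S. b j < x $ j)}) =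
    (LINT y|lborel. of_real (1 / sqrt (2 * pi)) * (\<Prod>j\<in>S. half_char (y * u $ j))) *
      (\<Prod>j\<in>-S. of_real (measure std_normal_distribution {b j<..}))"
proof -
  interpret G: prob_space "std_gaussian :: (real ^ 'n) measure" by (rule prob_space_std_gaussian)
  interpret N: prob_space std_normal_distribution by (rule prob_space_std_normal_distribution)
  define B where "B = {x :: real ^ 'n. (\<forall>j\<in>S. x $ j \<le> 0) \<and> (\<forall>j\<in>-S. b j < x $ j)}"
  have [measurable]: "B \<in> sets borel"
    unfolding B_def by measurable
  define uS where "uS = restrict_vec S u"
  define Y where "Y x = x - (x \<bullet> uS) *\<^sub>R uS" for x
  have [measurable]: "Y \<in> borel_measurable borel"
    unfolding Y_def[abs_def] by measurable
  have u1: "uS \<bullet> uS = 1"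
    using u by (simp add: uS_def inner_restrict_vec power2_eq_square cong: sum.cong)
  let ?c = "\<lambda>n. real (Suc n)"
  let ?m = "\<Prod>j\<in>-S. complex_of_real (measure std_normal_distribution {b j<..})"
  let ?I = "\<lambda>n x t. indicator B (Y x + (t / ?c n) *\<^sub>R uS) * exp (- (t / ?c n)\<^sup>2 / 2) :: real"
  have AE: "AE x in std_gaussian. \<forall>j\<in>S. Y x $ j \<noteq> 0"
    using AE_std_gaussian_residual_neq_0[OF u S nz]
    by eventually_elim (auto simp: Y_def uS_def)
  have "(\<lambda>n. LINT x|std_gaussian. LINT t|std_normal_distribution. ?I n x t) \<longlonglongrightarrow>
      (LINT x|std_gaussian. indicator B (Y x))"
  proof (rule integral_dominated_convergence[where w="\<lambda>_. 1"])
    show "AE x in std_gaussian. (\<lambda>n. LINT t|std_normal_distribution. ?I n x t) \<longlonglongrightarrow> indicator B (Y x)"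
      using AE
    proof eventually_elim
      case (elim x)
      have "(\<lambda>n. LINT t|std_normal_distribution. ?I n x t) \<longlonglongrightarrow> (LINT t|std_normal_distribution. indicator B (Y x))"
      proof (rule integral_dominated_convergence[where w="\<lambda>_. 1"])
        show "AE t in std_normal_distribution. (\<lambda>n. ?I n x t) \<longlonglongrightarrow> indicator B (Y x)"
        proof (rule AE_I2)
          fix t
          have "\<forall>\<^sub>F n in sequentially. indicator B (Y x) = (indicator B (Y x + (t / ?c n) *\<^sub>R uS) :: real)"
            using eventually_indicator_quadrant_eq[OF elim, where b = b and t = t and u = u]
            by eventually_elim (simp add: B_def uS_def indicator_def)
          then have 1: "(\<lambda>n. indicator B (Y x + (t / ?c n) *\<^sub>R uS) :: real) \<longlonglongrightarrow> indicator B (Y x)"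
            by (rule Lim_transform_eventually[OF tendsto_const])
          have "(\<lambda>n. exp (- (t / ?c n)\<^sup>2 / 2)) \<longlonglongrightarrow> exp (- 0\<^sup>2 / 2)"
            by (intro tendsto_intros tendsto_inverse_Suc_mult) auto
          from tendsto_mult[OF 1 this] show "(\<lambda>n. ?I n x t) \<longlonglongrightarrow> indicator B (Y x)" by simp
        qed
      qed (auto simp: indicator_def)
      then show ?case using N.prob_space by simp
    qed
    show "AE x in std_gaussian. norm (LINT t|std_normal_distribution. ?I n x t) \<le> 1" for n
    proof (rule AE_I2)
      fix x
      have "norm (LINT t|std_normal_distribution. ?I n x t) \<le> (LINT t|std_normal_distribution. norm (?I n x t))"
        by (rule integral_norm_bound)
      also have "\<dots> \<le> (LINT t|std_normal_distribution. 1)"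
        by (rule integral_mono') (auto simp: indicator_def)
      finally show "norm (LINT t|std_normal_distribution. ?I n x t) \<le> 1"
        using N.prob_space by simp
    qed
  qed auto
  then have lim1: "(\<lambda>n. complex_of_real (LINT x|std_gaussian. LINT t|std_normal_distribution. ?I n x t)) \<longlonglongrightarrow>
      of_real (LINT x|std_gaussian. indicator B (Y x))"
    by (rule tendsto_of_real)
  \<comment> \<open>Weak and strict inequalities on \<open>S\<close> define the same event up to a
    null set, because the residual has no zero coordinate there.\<close>
  have "(LINT x|std_gaussian. indicator B (Y x) :: real) = (LINT x|std_gaussian. indicator
      {x. (\<forall>j\<in>S. x $ j < (x \<bullet> restrict_vec S u) * u $ j) \<and> (\<forall>j\<in>-S. b j < x $ j)} x)"
  proof (rule integral_cong_AE)
    show "AE x in std_gaussian. indicator B (Y x) = (indicator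
      {x. (\<forall>j\<in>S. x $ j < (x \<bullet> restrict_vec S u) * u $ j) \<and> (\<forall>j\<in>-S. b j < x $ j)} x :: real)"
      using AE
    proof eventually_elim
      case (elim x)
      have "Y x $ j \<le> 0 \<longleftrightarrow> x $ j < (x \<bullet> restrict_vec S u) * u $ j" if "j \<in> S" for j
        using elim that by (force simp: Y_def uS_def)
      moreover have "Y x $ j = x $ j" if "j \<notin> S" for j
        using that by (simp add: Y_def uS_def)
      ultimately show ?case
        by (auto simp: indicator_def B_def)
    qed
  qed measurable
  also have "\<dots> = measure std_gaussian
      {x. (\<forall>j\<in>S. x $ j < (x \<bullet> restrict_vec S u) * u $ j) \<and> (\<forall>j\<in>-S. b j < x $ j)}"
    by simp
  finally have lhs: "(LINT x|std_gaussian. indicator B (Y x)) = measure std_gaussian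
      {x. (\<forall>j\<in>S. x $ j < (x \<bullet> restrict_vec S u) * u $ j) \<and> (\<forall>j\<in>-S. b j < x $ j)}" .
  have "(\<lambda>n. LINT y|lborel. of_real (exp (- (y / ?c n)\<^sup>2 / 2) / sqrt (2 * pi)) * (\<Prod>j\<in>S. half_char (y * u $ j))) \<longlonglongrightarrow>
     (LINT y|lborel. of_real (1 / sqrt (2 * pi)) * (\<Prod>j\<in>S. half_char (y * u $ j)))"
  proof (rule integral_dominated_convergence[where w="\<lambda>y. norm (\<Prod>j\<in>S. half_char (y * u $ j))"])
    show "integrable lborel (\<lambda>y. norm (\<Prod>j\<in>S. half_char (y * u $ j)))"
      by (intro integrable_norm integrable_half_char_prod S nz) auto
    show "AE y in lborel. (\<lambda>n. of_real (exp (- (y / ?c n)\<^sup>2 / 2) / sqrt (2 * pi)) * (\<Prod>j\<in>S. half_char (y * u $ j)))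
        \<longlonglongrightarrow> of_real (1 / sqrt (2 * pi)) * (\<Prod>j\<in>S. half_char (y * u $ j))"
    proof (rule AE_I2)
      fix y
      have "(\<lambda>n. exp (- (y / ?c n)\<^sup>2 / 2) / sqrt (2 * pi)) \<longlonglongrightarrow> exp (- 0\<^sup>2 / 2) / sqrt (2 * pi)"
        by (intro tendsto_intros tendsto_inverse_Suc_mult) auto
      then show "(\<lambda>n. of_real (exp (- (y / ?c n)\<^sup>2 / 2) / sqrt (2 * pi)) * (\<Prod>j\<in>S. half_char (y * u $ j)))
        \<longlonglongrightarrow> of_real (1 / sqrt (2 * pi)) * (\<Prod>j\<in>S. half_char (y * u $ j))"
        by (intro tendsto_mult tendsto_const tendsto_of_real) simp
    qed
    show "AE y in lborel. norm (of_real (exp (- (y / ?c n)\<^sup>2 / 2) / sqrt (2 * pi)) * (\<Prod>j\<in>S. half_char (y * u $ j)))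
        \<le> norm (\<Prod>j\<in>S. half_char (y * u $ j))" for n
    proof (rule AE_I2)
      fix y
      \<comment> \<open>This keeps the weight at most 1, so the product of the
        \<open>half_char\<close> factors alone is a dominating function.\<close>
      have "sqrt (2 * pi) \<ge> 1" using pi_gt3 by simp
      then have "exp (- (y / ?c n)\<^sup>2 / 2) / sqrt (2 * pi) \<le> 1 / 1"
        by (intro frac_le) auto
      then show "norm (of_real (exp (- (y / ?c n)\<^sup>2 / 2) / sqrt (2 * pi)) * (\<Prod>j\<in>S. half_char (y * u $ j)))
        \<le> norm (\<Prod>j\<in>S. half_char (y * u $ j))"
        unfolding norm_mult norm_of_real by (intro mult_left_le_one_le) auto
    qed
  qed measurable
  then have lim2: "(\<lambda>n. (LINT y|lborel. of_real (exp (- (y / ?c n)\<^sup>2 / 2) / sqrt (2 * pi)) * (\<Prod>j\<in>S. half_char (y * u $ j))) * ?m) \<longlonglongrightarrow>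
     (LINT y|lborel. of_real (1 / sqrt (2 * pi)) * (\<Prod>j\<in>S. half_char (y * u $ j))) * ?m"
    by (intro tendsto_mult tendsto_const)
  have "(LINT y|lborel. of_real (exp (- (y / ?c n)\<^sup>2 / 2) / sqrt (2 * pi)) * (\<Prod>j\<in>S. half_char (y * u $ j))) * ?m =
      of_real (LINT x|std_gaussian. LINT t|std_normal_distribution. ?I n x t)" for n
    unfolding integral_half_char_prod_regularized[where c = "?c n" and S = S and u = u and b = b, OF of_nat_0_less_iff[THEN iffD2, OF zero_less_Suc], folded B_def uS_def]
    by (subst integral_std_gaussian_concentrate[OF u1]) (auto simp: Y_def)
  with lim2 have "(\<lambda>n. complex_of_real (LINT x|std_gaussian. LINT t|std_normal_distribution. ?I n x t)) \<longlonglongrightarrow>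
     (LINT y|lborel. of_real (1 / sqrt (2 * pi)) * (\<Prod>j\<in>S. half_char (y * u $ j))) * ?m"
    by simp
  from LIMSEQ_unique[OF lim1 this] show ?thesis
    unfolding lhs .
qed

lemma measure_std_normal_greaterThan: "of_real (measure std_normal_distribution {b<..}) = Phi (of_real (- b))"
proof -
  have "measure std_normal_distribution {b<..} = (LINT s|std_normal_distribution. indicator {b<..} s)"
    by simp
  also have "\<dots> = (LINT s|lborel. indicator {b<..} s * std_normal_density s)"
    by (subst integral_density) (auto simp: mult.commute)
  also have "\<dots> = (LINT s|lborel. indicator {..< -b} s * std_normal_density s)"
    by (subst lborel_integral_real_affine[of "-1" _ 0])
       (auto intro!: Bochner_Integration.integral_cong simp: indicator_def std_normal_density_def)
  also have "\<dots> = (LINT s|lborel. indicator {.. -b} s * std_normal_density s)"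
    using AE_lborel_singleton[of "-b"]
    by (intro integral_cong_AE) (auto simp: indicator_def)
  also have "\<dots> = (LINT s|std_normal_distribution. indicator {.. -b} s)"
    by (subst integral_density) (auto simp: mult.commute)
  finally show ?thesis
    unfolding Phi_of_real by simp
qed

text \<open>Since u has norm 1 on \<open>S\<close>, the factors exp ((y u_j)^2 / 2) multiply to exp
  (y^2 / 2), which is exactly what the normal density of y cancels.\<close>

lemma measure_std_gaussian_residual_quadrant:
  fixes u :: "real ^ 'n::finite" and S :: "'n set" and b :: "'n \<Rightarrow> real"
  assumes u: "(\<Sum>j\<in>S. (u $ j)\<^sup>2) = 1" and S: "2 \<le> card S" and nz: "\<And>j. u $ j \<noteq> 0"
  shows "of_real (measure std_gaussian
      {x. (\<forall>j\<in>S. x $ j < (x \<bullet> restrict_vec S u) * u $ j) \<and> (\<forall>j\<in>-S. b j < x $ j)}) =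
    (LINT y|std_normal_distribution. (\<Prod>j\<in>S. Phi (\<i> * of_real (y * u $ j)))) *
      (\<Prod>j\<in>-S. Phi (of_real (- b j)))"
proof -
  have eq: "of_real (1 / sqrt (2 * pi)) * (\<Prod>j\<in>S. half_char (y * u $ j)) =
      std_normal_density y *\<^sub>R (\<Prod>j\<in>S. Phi (\<i> * of_real (y * u $ j)))" for y
  proof -
    have "(\<Sum>j\<in>S. (y * u $ j)\<^sup>2 / 2) = y\<^sup>2 / 2 * (\<Sum>j\<in>S. (u $ j)\<^sup>2)"
      by (simp add: power_mult_distrib sum_distrib_left)
    then have "(\<Prod>j\<in>S. exp ((y * u $ j)\<^sup>2 / 2)) = exp (y\<^sup>2 / 2)"
      using u by (simp add: exp_sum[symmetric])
    then have "(\<Prod>j\<in>S. Phi (\<i> * of_real (y * u $ j))) = of_real (exp (y\<^sup>2 / 2)) * (\<Prod>j\<in>S. half_char (y * u $ j))"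
      unfolding Phi_imaginary prod.distrib of_real_prod[symmetric] by simp
    moreover have "std_normal_density y * exp (y\<^sup>2 / 2) = 1 / sqrt (2 * pi)"
      by (simp add: std_normal_density_def exp_minus field_simps)
    ultimately show ?thesis
      by (simp only: scaleR_conv_of_real mult.assoc[symmetric] of_real_mult[symmetric])
  qed
  have "(LINT y|lborel. std_normal_density y *\<^sub>R (\<Prod>j\<in>S. Phi (\<i> * of_real (y * u $ j)))) =
    (LINT y|std_normal_distribution. (\<Prod>j\<in>S. Phi (\<i> * of_real (y * u $ j))))"
    by (subst integral_density) auto
  then show ?thesis
    unfolding measure_std_gaussian_residual_quadrant_half_char[OF u S nz] eq measure_std_normal_greaterThan
    by simp
qed

theorem measure_std_gaussian_cell:
  fixes u :: "real ^ 'n::finite" and S :: "'n set"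
  assumes u: "(\<Sum>j\<in>S. (u $ j)\<^sup>2) = 1" and S: "2 \<le> card S" and nz: "\<And>j. u $ j \<noteq> 0"
  shows "of_real (measure std_gaussian
      {x. (\<forall>j\<in>S. x $ j < (x \<bullet> restrict_vec S u) * u $ j) \<and> (\<forall>j\<in>-S. (x \<bullet> restrict_vec S u) * u $ j < x $ j)}) =
    (LINT y|std_normal_distribution. (\<Prod>j\<in>S. Phi (\<i> * of_real (y * u $ j)))) *
    (LINT y|std_normal_distribution. (\<Prod>j\<in>-S. Phi (of_real (y * u $ j))))"
proof -
  interpret G: prob_space "std_gaussian :: (real ^ 'n) measure" by (rule prob_space_std_gaussian)
  interpret N: prob_space std_normal_distribution by (rule prob_space_std_normal_distribution)
  interpret P: pair_prob_space "std_gaussian :: (real ^ 'n) measure" std_normal_distribution ..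
  define A where "A = {x. (\<forall>j\<in>S. x $ j < (x \<bullet> restrict_vec S u) * u $ j) \<and> (\<forall>j\<in>-S. (x \<bullet> restrict_vec S u) * u $ j < x $ j)}"
  have [measurable]: "A \<in> sets borel"
    unfolding A_def by measurable
  define uS where "uS = restrict_vec S u"
  have u1: "uS \<bullet> uS = 1"
    using u by (simp add: uS_def inner_restrict_vec power2_eq_square cong: sum.cong)
  let ?Z = "\<lambda>x w. x - (x \<bullet> uS) *\<^sub>R uS + w *\<^sub>R uS"
  let ?Q = "\<lambda>w. {x. (\<forall>j\<in>S. x $ j < (x \<bullet> restrict_vec S u) * u $ j) \<and> (\<forall>j\<in>-S. w * u $ j < x $ j)}"
  \<comment> \<open>Resampling adds (w - W) u_j to both sides of each inequality on
    \<open>S\<close>, so these depend on the residual alone; off \<open>S\<close> only the threshold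
    changes, to w * u_j.\<close>
  have Z: "?Z x w \<in> A \<longleftrightarrow> x \<in> ?Q w" for x w
  proof -
    have "?Z x w \<bullet> uS = w"
      using u1 by (simp add: inner_add_left inner_diff_left)
    then show ?thesis
      by (auto simp: A_def uS_def[symmetric]) (auto simp: uS_def)
  qed
  have "measure std_gaussian A = (LINT x|std_gaussian. indicator A x)"
    by simp
  also have "\<dots> = (LINT z|(std_gaussian \<Otimes>\<^sub>M std_normal_distribution). indicator A (?Z (fst z) (snd z)))"
    by (subst distr_std_gaussian_resample[OF u1, symmetric], subst integral_distr)
       (auto simp: case_prod_beta)
  also have "\<dots> = (LINT w|std_normal_distribution. LINT x|std_gaussian. indicator A (?Z x w))"
    by (subst P.integral_snd[where f = "\<lambda>x w. indicator A (?Z x w)"])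
       (auto simp: case_prod_beta' intro!: P.P.integrable_const_bound[where B=1])
  also have "\<dots> = (LINT w|std_normal_distribution. measure std_gaussian (?Q w))"
  proof (rule Bochner_Integration.integral_cong[OF refl])
    fix w
    have "(LINT x|std_gaussian. indicator A (?Z x w) :: real) = (LINT x|std_gaussian. indicator (?Q w) x)"
      using Z by (intro Bochner_Integration.integral_cong) (auto simp: indicator_def)
    then show "(LINT x|std_gaussian. indicator A (?Z x w)) = measure std_gaussian (?Q w)" by simp
  qed
  finally have "complex_of_real (measure std_gaussian A) =
      (LINT w|std_normal_distribution. of_real (measure std_gaussian (?Q w)))"
    by (simp add: integral_complex_of_real)
  also have "\<dots> = (LINT w|std_normal_distribution. (LINT y|std_normal_distribution. (\<Prod>j\<in>S. Phi (\<i> * of_real (y * u $ j)))) *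
      (\<Prod>j\<in>-S. Phi (of_real (- (w * u $ j)))))"
    by (rule Bochner_Integration.integral_cong[OF refl]) (rule measure_std_gaussian_residual_quadrant[OF u S nz])
  also have "\<dots> = (LINT y|std_normal_distribution. (\<Prod>j\<in>S. Phi (\<i> * of_real (y * u $ j)))) *
      (LINT w|std_normal_distribution. (\<Prod>j\<in>-S. Phi (of_real (- (w * u $ j)))))"
    by (rule integral_mult_right_zero)
  also have "(LINT w|std_normal_distribution. (\<Prod>j\<in>-S. Phi (of_real (- (w * u $ j))))) =
      (LINT w|lborel. std_normal_density w *\<^sub>R (\<Prod>j\<in>-S. Phi (of_real (- (w * u $ j)))))"
    by (subst integral_density) auto
  \<comment> \<open>The thresholds yield \<open>Phi\<close> at -w u_j; reflecting w removes the
    sign.\<close>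
  also have "\<dots> = (LINT w|lborel. std_normal_density w *\<^sub>R (\<Prod>j\<in>-S. Phi (of_real (w * u $ j))))"
    by (subst lborel_integral_real_affine[of "-1" _ 0]) (auto simp: std_normal_density_def)
  also have "\<dots> = (LINT w|std_normal_distribution. (\<Prod>j\<in>-S. Phi (of_real (w * u $ j))))"
    by (subst integral_density) auto
  finally show ?thesis
    unfolding A_def .
qed

section \<open>Faces of the cone and projections onto them\<close>

lemma line_plus_orthant_iff:
  "z \<in> span {v} + nonneg_orthant \<longleftrightarrow> (\<exists>t a. (\<forall>j. 0 \<le> a $ j) \<and> z = t *\<^sub>R v + a)"
  unfolding set_plus_def span_singleton nonneg_orthant_def by blast

lemma line_plus_orthantI: "(\<And>j. 0 \<le> a $ j) \<Longrightarrow> t *\<^sub>R v + a \<in> span {v} + nonneg_orthant"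
  by (auto simp: line_plus_orthant_iff)

lemma convex_cone_line_plus_orthant: "convex_cone (span {v} + (nonneg_orthant :: (real ^ 'n::finite) set))"
  unfolding convex_cone_iff
proof (intro conjI ballI allI impI)
  show "0 \<in> span {v} + (nonneg_orthant :: (real ^ 'n) set)"
    using line_plus_orthantI[of 0 0 v] by simp
  fix x y :: "real ^ 'n" and c :: real
  assume "x \<in> span {v} + nonneg_orthant"
  then obtain t and a :: "real ^ 'n" where x: "\<forall>j. 0 \<le> a $ j" "x = t *\<^sub>R v + a"
    by (auto simp: line_plus_orthant_iff)
  show "c *\<^sub>R x \<in> span {v} + nonneg_orthant" if "0 \<le> c"
    using line_plus_orthantI[of "c *\<^sub>R a" "c * t" v] x that by (simp add: scaleR_add_right)
  assume "y \<in> span {v} + nonneg_orthant"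
  then obtain s and b :: "real ^ 'n" where y: "\<forall>j. 0 \<le> b $ j" "y = s *\<^sub>R v + b"
    by (auto simp: line_plus_orthant_iff)
  show "x + y \<in> span {v} + nonneg_orthant"
    using line_plus_orthantI[of "a + b" "t + s" v] x y by (simp add: algebra_simps)
qed

lemma vec_eq_sum_axis: "(a :: real ^ 'n::finite) = (\<Sum>j\<in>UNIV. a $ j *\<^sub>R axis j 1)"
  by (simp add: vec_eq_iff axis_def if_distrib[of "(*) _"] cong: if_cong)

text \<open>The cone is generated by v, -v and the coordinate vectors, hence finitely generated.
  Closedness and finiteness of the set of faces come from this.\<close>

lemma polyhedron_line_plus_orthant:
  "polyhedron (span {v} + (nonneg_orthant :: (real ^ 'n::finite) set))"
proof -
  let ?G = "insert v (insert (- v) (range (\<lambda>j. axis j 1)))"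
  have "span {v} + nonneg_orthant = convex_cone hull ?G"
  proof
    show "convex_cone hull ?G \<subseteq> span {v} + nonneg_orthant"
    proof (rule hull_minimal)
      show "?G \<subseteq> span {v} + nonneg_orthant"
        using line_plus_orthantI[of 0 1 v] line_plus_orthantI[of 0 "-1" v]
          line_plus_orthantI[of "axis _ 1" 0 v] by (auto simp: axis_def)
    qed (rule convex_cone_line_plus_orthant)
    show "span {v} + nonneg_orthant \<subseteq> convex_cone hull ?G"
    proof
      fix z :: "real ^ 'n" assume "z \<in> span {v} + nonneg_orthant"
      then obtain t and a :: "real ^ 'n" where a: "\<forall>j. 0 \<le> a $ j" and z: "z = t *\<^sub>R v + a"
        by (auto simp: line_plus_orthant_iff)
      have gen: "g \<in> convex_cone hull ?G" if "g \<in> ?G" for g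
        using that by (rule hull_inc)
      have "t *\<^sub>R v \<in> convex_cone hull ?G"
      proof (cases "0 \<le> t")
        case True then show ?thesis by (intro convex_cone_hull_mul gen) auto
      next
        case False
        then have "(- t) *\<^sub>R (- v) \<in> convex_cone hull ?G" by (intro convex_cone_hull_mul gen) auto
        then show ?thesis by simp
      qed
      moreover have "(\<Sum>j\<in>J. a $ j *\<^sub>R axis j 1) \<in> convex_cone hull ?G" if "finite J" for J
        using that
      proof induction
        case (insert j J)
        have "a $ j *\<^sub>R axis j 1 \<in> convex_cone hull ?G"
          using a by (intro convex_cone_hull_mul gen) auto
        from convex_cone_hull_add[OF this insert.IH] show ?case
          by (simp only: sum.insert[OF insert.hyps])
      qed (simp add: convex_cone_hull_contains_0)
      ultimately show "z \<in> convex_cone hull ?G"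
        unfolding z by (subst (2) vec_eq_sum_axis) (intro convex_cone_hull_add, auto)
    qed
  qed
  then show ?thesis
    using polyhedron_convex_cone_hull[of ?G] by simp
qed

text \<open>A face of the cone whenever some vector orthogonal to \<open>v\<close> is positive on
  \<open>S\<close> and zero elsewhere, as the next lemmas show.\<close>

definition orthant_face :: "real ^ 'n \<Rightarrow> 'n set \<Rightarrow> (real ^ 'n) set" where
  "orthant_face v S = {z. \<exists>t a. (\<forall>j. 0 \<le> a $ j) \<and> (\<forall>j\<in>S. a $ j = 0) \<and> z = t *\<^sub>R v + a}"

text \<open>Since y is orthogonal to v, y . (t v + a) = y . a is a sum of nonnegative terms, zero
  exactly when a vanishes on the support of y.\<close>

lemma orthant_face_eq_Int_hyperplane:
  fixes v y :: "real ^ 'n::finite"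
  assumes "y \<bullet> v = 0" "\<And>j. j \<in> S \<Longrightarrow> 0 < y $ j" "\<And>j. j \<notin> S \<Longrightarrow> y $ j = 0"
  shows "orthant_face v S = (span {v} + nonneg_orthant) \<inter> {z. y \<bullet> z = 0}"
proof -
  have "y \<bullet> a = 0 \<longleftrightarrow> (\<forall>j\<in>S. a $ j = 0)" if a: "\<forall>j. 0 \<le> a $ j" for a :: "real ^ 'n"
  proof -
    have "y \<bullet> a = (\<Sum>j\<in>UNIV. y $ j * a $ j)" by (simp add: inner_vec_def)
    also have "\<dots> = (\<Sum>j\<in>S. y $ j * a $ j)"
      using assms(3) by (intro sum.mono_neutral_right) auto
    also have "\<dots> = 0 \<longleftrightarrow> (\<forall>j\<in>S. y $ j * a $ j = 0)"
      using a assms(2) by (subst sum_nonneg_eq_0_iff) (auto intro: mult_nonneg_nonneg less_imp_le)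
    also have "\<dots> \<longleftrightarrow> (\<forall>j\<in>S. a $ j = 0)"
      using assms(2) by fastforce
    finally show ?thesis .
  qed
  then show ?thesis
    using assms(1) by (fastforce simp: orthant_face_def line_plus_orthant_iff inner_add_right)
qed

text \<open>A basis of the span is v with the axes outside \<open>S\<close>: those axes span only
  vectors vanishing on \<open>S\<close>, where v has a nonzero entry.\<close>

lemma aff_dim_orthant_face:
  fixes v :: "real ^ 'n::finite"
  assumes "\<And>j. v $ j \<noteq> 0" "S \<noteq> {}"
  shows "aff_dim (orthant_face v S) = int (CARD('n) + 1 - card S)"
proof -
  let ?A = "(\<lambda>j. axis j 1 :: real ^ 'n) ` (- S)"
  have mem: "t *\<^sub>R v + a \<in> orthant_face v S" if "\<And>j. 0 \<le> a $ j" "\<And>j. j \<in> S \<Longrightarrow> a $ j = 0"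
    for t and a :: "real ^ 'n"
    using that by (auto simp: orthant_face_def)
  have "dim (orthant_face v S) = card (insert v ?A)"
  proof (rule dim_unique[OF _ _ _ refl])
    show "insert v ?A \<subseteq> orthant_face v S"
    proof -
      have "v \<in> orthant_face v S" using mem[of 0 1] by simp
      moreover have "axis j 1 \<in> orthant_face v S" if "j \<notin> S" for j
        by (rule mem[of "axis j 1" 0, simplified]) (use that in \<open>auto simp: axis_def\<close>)
      ultimately show ?thesis by auto
    qed
    show "orthant_face v S \<subseteq> span (insert v ?A)"
    proof
      fix z assume "z \<in> orthant_face v S"
      then obtain t and a :: "real ^ 'n" where a: "\<forall>j\<in>S. a $ j = 0" and z: "z = t *\<^sub>R v + a"
        by (auto simp: orthant_face_def)
      have "a = (\<Sum>j\<in>-S. a $ j *\<^sub>R axis j 1)"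
        by (subst vec_eq_sum_axis) (use a in \<open>auto intro!: sum.mono_neutral_right\<close>)
      then show "z \<in> span (insert v ?A)"
        unfolding z by (metis (no_types, lifting) span_add span_mul span_base insertI1 insertI2 image_eqI span_sum)
    qed
    have "v \<notin> span ?A"
    proof
      assume "v \<in> span ?A"
      moreover have "span ?A \<subseteq> {z. \<forall>j\<in>S. z $ j = 0}"
        by (rule span_minimal) (auto simp: subspace_def axis_def)
      ultimately show False using assms by auto
    qed
    moreover have "independent ?A"
      by (rule independent_mono[OF independent_Basis]) (auto simp: Basis_vec_def)
    ultimately show "independent (insert v ?A)"
      by (simp add: independent_insert)
  qed
  also have "card (insert v ?A) = CARD('n) + 1 - card S"
  proof -
    have "v \<notin> ?A"
    proof
      assume "v \<in> ?A"
      then obtain j where "j \<notin> S" "v = axis j 1" by auto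
      moreover obtain s where "s \<in> S" using assms by auto
      ultimately have "v $ s = 0" by (auto simp: axis_def)
      then show False using assms(1) by blast
    qed
    moreover have "card ?A = CARD('n) - card S"
      by (subst card_image) (auto simp: inj_on_def axis_eq_axis Compl_eq_Diff_UNIV card_Diff_subset)
    moreover have "card S \<le> CARD('n)" by (rule card_mono) auto
    ultimately show ?thesis by simp
  qed
  finally have "dim (orthant_face v S) = CARD('n) + 1 - card S" .
  moreover have "0 \<in> affine hull (orthant_face v S)"
    using mem[of 0 0] by (auto intro: hull_inc)
  ultimately show ?thesis
    by (simp add: aff_dim_zero)
qed

text \<open>A coordinate s in \<open>S\<close> determines t as z_s / v_s throughout the affine hull.
  Positivity of the remaining coordinates of z - t v is therefore the open condition
  \<open>T\<close>.\<close>

lemma rel_interior_orthant_face: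
  fixes v a :: "real ^ 'n::finite"
  assumes "\<And>j. v $ j \<noteq> 0" "S \<noteq> {}" "\<And>j. j \<in> S \<Longrightarrow> a $ j = 0" "\<And>j. j \<notin> S \<Longrightarrow> 0 < a $ j"
  shows "t *\<^sub>R v + a \<in> rel_interior (orthant_face v S)"
proof -
  obtain s where s: "s \<in> S" using assms by auto
  define V where "V = {z :: real ^ 'n. \<exists>r. \<forall>j\<in>S. z $ j = r * v $ j}"
  define T where "T = (\<Inter>j\<in>-S. {z. 0 < z $ j - z $ s / v $ s * v $ j})"
  have "subspace V"
    unfolding subspace_def V_def
  proof (intro conjI ballI allI; safe)
    show "\<exists>r. \<forall>j\<in>S. 0 $ j = r * v $ j" by (intro exI[of _ 0]) auto
    show "\<exists>r. \<forall>j\<in>S. (x + y) $ j = r * v $ j"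
      if "\<forall>j\<in>S. x $ j = r1 * v $ j" "\<forall>j\<in>S. y $ j = r2 * v $ j" for x y r1 r2
      using that by (intro exI[of _ "r1 + r2"]) (auto simp: algebra_simps)
    show "\<exists>r. \<forall>j\<in>S. (c *\<^sub>R x) $ j = r * v $ j" if "\<forall>j\<in>S. x $ j = r1 * v $ j" for c x r1
      using that by (intro exI[of _ "c * r1"]) auto
  qed
  moreover have "orthant_face v S \<subseteq> V"
    unfolding orthant_face_def V_def by auto
  ultimately have hull: "affine hull (orthant_face v S) \<subseteq> V"
    by (intro hull_minimal subspace_imp_affine)
  have "open T"
    unfolding T_def by (intro open_INT ballI open_Collect_less continuous_intros) (auto simp: assms(1))
  moreover have "t *\<^sub>R v + a \<in> T"
  proof -
    have "v $ s \<noteq> 0" "a $ s = 0" using assms(1,3) s by auto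
    then show ?thesis using assms(4) by (simp add: T_def)
  qed
  moreover have "t *\<^sub>R v + a \<in> orthant_face v S"
  proof -
    have "0 \<le> a $ j" for j using assms(3,4) by (cases "j \<in> S") (auto intro: less_imp_le)
    then show ?thesis using assms(3) unfolding orthant_face_def by blast
  qed
  moreover have "T \<inter> affine hull (orthant_face v S) \<subseteq> orthant_face v S"
  proof
    fix z assume "z \<in> T \<inter> affine hull (orthant_face v S)"
    then have "z \<in> T" "z \<in> V" using hull by auto
    then obtain r where r: "\<forall>j\<in>S. z $ j = r * v $ j" by (auto simp: V_def)
    then have rs: "z $ s / v $ s = r" using s assms(1)[of s] by simp
    have "\<forall>j\<in>-S. 0 < z $ j - z $ s / v $ s * v $ j"
      using \<open>z \<in> T\<close> unfolding T_def by blast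
    then have "0 \<le> (z - r *\<^sub>R v) $ j" for j
      using r unfolding rs by (cases "j \<in> S") (auto intro: less_imp_le)
    moreover have "\<forall>j\<in>S. (z - r *\<^sub>R v) $ j = 0" using r by simp
    moreover have "z = r *\<^sub>R v + (z - r *\<^sub>R v)" by simp
    ultimately show "z \<in> orthant_face v S"
      unfolding orthant_face_def by blast
  qed
  ultimately show ?thesis
    unfolding mem_rel_interior by blast
qed

text \<open>Here l is the least-squares coefficient of x along v on \<open>S\<close>. For empty
  \<open>S\<close> the quotient 0 / 0 is 0 and the cell is the open positive orthant; the lemmas on
  projections take \<open>S\<close> nonempty.\<close>

definition cell :: "real ^ 'n \<Rightarrow> 'n set \<Rightarrow> (real ^ 'n) set" where
  "cell v S = {x. let l = (\<Sum>j\<in>S. x $ j * v $ j) / (\<Sum>j\<in>S. (v $ j)\<^sup>2) in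
    (\<forall>j\<in>S. x $ j < l * v $ j) \<and> (\<forall>j\<in>-S. l * v $ j < x $ j)}"

lemma closest_pointI:
  fixes x p :: "'a::euclidean_space"
  assumes "convex C" "closed C" "p \<in> C" and obtuse: "\<And>z. z \<in> C \<Longrightarrow> (x - p) \<bullet> (z - p) \<le> 0"
  shows "closest_point C x = p"
proof (rule closest_point_unique[symmetric, OF assms(1-3)], rule ballI)
  fix z assume "z \<in> C"
  have "(x - z) \<bullet> (x - z) = (x - p) \<bullet> (x - p) + (z - p) \<bullet> (z - p) - 2 * ((x - p) \<bullet> (z - p))"
    by (simp add: inner_diff_left inner_diff_right inner_commute)
  also have "\<dots> \<ge> (x - p) \<bullet> (x - p)"
    using obtuse[OF \<open>z \<in> C\<close>] inner_ge_zero[of "z - p"] by linarith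
  finally show "dist x p \<le> dist x z"
    by (simp add: dist_norm norm_eq_sqrt_inner)
qed

text \<open>The certificate is y = p - x: it is nonnegative on the cone and orthogonal to p, so p is
  the projection. The first claim recovers \<open>S\<close> from x and thus makes distinct cells
  disjoint.\<close>

lemma closest_point_cell:
  fixes v x :: "real ^ 'n::finite"
  defines "P \<equiv> span {v} + nonneg_orthant"
  assumes v: "\<And>j. v $ j \<noteq> 0" and S: "S \<noteq> {}" and x: "x \<in> cell v S"
  shows "S = {j. x $ j < closest_point P x $ j}"
    and "orthant_face v S face_of P"
    and "closest_point P x \<in> rel_interior (orthant_face v S)"
proof -
  define l where "l = (\<Sum>j\<in>S. x $ j * v $ j) / (\<Sum>j\<in>S. (v $ j)\<^sup>2)"
  have less: "\<And>j. j \<in> S \<Longrightarrow> x $ j < l * v $ j" "\<And>j. j \<notin> S \<Longrightarrow> l * v $ j < x $ j"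
    using x by (auto simp: cell_def l_def Let_def)
  define a where "a = (\<chi> j. if j \<in> S then 0 else x $ j - l * v $ j)"
  define p where "p = l *\<^sub>R v + a"
  define y where "y = p - x"
  have y: "y $ j = (if j \<in> S then l * v $ j - x $ j else 0)" for j
    by (simp add: y_def p_def a_def)
  have pos: "(\<Sum>j\<in>S. (v $ j)\<^sup>2) > 0"
    using v S by (intro sum_pos) auto
  have "y \<bullet> v = (\<Sum>j\<in>UNIV. y $ j * v $ j)" by (simp add: inner_vec_def)
  also have "\<dots> = (\<Sum>j\<in>S. y $ j * v $ j)"
    by (intro sum.mono_neutral_right) (auto simp: y)
  \<comment> \<open>This vanishes by the choice of l, which makes the residual on \<open>S\<close>
    orthogonal to v.\<close>
  also have "\<dots> = l * (\<Sum>j\<in>S. (v $ j)\<^sup>2) - (\<Sum>j\<in>S. x $ j * v $ j)"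
    by (simp add: y algebra_simps sum_subtractf sum_distrib_left power2_eq_square)
  also have "\<dots> = 0" using pos by (simp add: l_def)
  finally have yv: "y \<bullet> v = 0" .
  have ya: "y \<bullet> a = 0"
    by (auto simp: inner_vec_def y a_def intro!: sum.neutral)
  have y0: "0 \<le> y $ j" for j using less by (auto simp: y intro: less_imp_le)
  have yP: "0 \<le> y \<bullet> z" if z: "z \<in> P" for z
  proof -
    from z obtain t and b :: "real ^ 'n" where "\<forall>j. 0 \<le> b $ j" "z = t *\<^sub>R v + b"
      by (auto simp: P_def line_plus_orthant_iff)
    moreover from this have "0 \<le> y \<bullet> b"
      using y0 by (auto simp: inner_vec_def intro!: sum_nonneg)
    ultimately show ?thesis by (simp add: inner_add_right yv)
  qed
  have poly: "polyhedron P" unfolding P_def by (rule polyhedron_line_plus_orthant)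
  then have conv: "convex P" and cl: "closed P"
    by (auto simp: polyhedron_imp_convex polyhedron_imp_closed)
  have a0: "0 \<le> a $ j" for j using less by (auto simp: a_def intro: less_imp_le)
  then have pP: "p \<in> P" unfolding p_def P_def by (rule line_plus_orthantI)
  have cp: "closest_point P x = p"
  proof (rule closest_pointI[OF conv cl pP])
    fix z assume "z \<in> P"
    have "(x - p) \<bullet> (z - p) = y \<bullet> p - y \<bullet> z"
      by (simp add: y_def inner_diff_left inner_diff_right)
    also have "y \<bullet> p = 0" by (simp add: p_def inner_add_right yv ya)
    finally show "(x - p) \<bullet> (z - p) \<le> 0" using yP[OF \<open>z \<in> P\<close>] by simp
  qed
  have "x $ j < p $ j \<longleftrightarrow> 0 < y $ j" for j by (simp add: y_def)
  then show "S = {j. x $ j < closest_point P x $ j}"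
    using less by (auto simp: cp y split: if_splits)
  have "orthant_face v S = P \<inter> {z. y \<bullet> z = 0}"
    unfolding P_def by (rule orthant_face_eq_Int_hyperplane) (use yv less in \<open>auto simp: y\<close>)
  then show "orthant_face v S face_of P"
    using face_of_Int_supporting_hyperplane_ge[OF conv, where a = y and b = 0] yP by simp
  show "closest_point P x \<in> rel_interior (orthant_face v S)"
    unfolding cp p_def by (rule rel_interior_orthant_face) (use v S less in \<open>auto simp: a_def\<close>)
qed

text \<open>Converse direction: \<open>S\<close> is read off as the support of y = p - x.
  Complementary slackness makes a vanish on \<open>S\<close>, and genericity excludes a further zero
  of a outside \<open>S\<close>.\<close>

lemma mem_cell_if_not_mem:
  fixes v x :: "real ^ 'n::finite"
  defines "P \<equiv> span {v} + nonneg_orthant"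
  assumes v: "\<And>j. v $ j \<noteq> 0" and xP: "x \<notin> P"
    and generic: "\<And>S j. S \<noteq> {} \<Longrightarrow> j \<notin> S \<Longrightarrow>
      x $ j \<noteq> (\<Sum>j\<in>S. x $ j * v $ j) / (\<Sum>j\<in>S. (v $ j)\<^sup>2) * v $ j"
  obtains S where "S \<noteq> {}" "x \<in> cell v S"
proof -
  have poly: "polyhedron P" unfolding P_def by (rule polyhedron_line_plus_orthant)
  then have conv: "convex P" and cl: "closed P"
    by (auto simp: polyhedron_imp_convex polyhedron_imp_closed)
  have cone: "convex_cone P" unfolding P_def by (rule convex_cone_line_plus_orthant)
  define p where "p = closest_point P x"
  define y where "y = p - x"
  have pP: "p \<in> P"
    unfolding p_def using cl convex_cone_nonempty[OF cone] by (rule closest_point_in_set)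
  have dot: "(x - p) \<bullet> (z - p) \<le> 0" if "z \<in> P" for z
    unfolding p_def by (rule closest_point_dot[OF conv cl that])
  \<comment> \<open>Test the projection inequality at p + q, which stays in the cone.\<close>
  have yq: "0 \<le> y \<bullet> q" if "q \<in> P" for q
    using dot[OF convex_cone_add[OF cone pP that]] by (simp add: y_def inner_diff_left)
  have mem: "t *\<^sub>R v + a \<in> P" if "\<And>j. 0 \<le> a $ j" for t and a :: "real ^ 'n"
    using that unfolding P_def by (rule line_plus_orthantI)
  have yv: "y \<bullet> v = 0"
    using yq[OF mem[of 0 1]] yq[OF mem[of 0 "-1"]] by simp
  have y0: "0 \<le> y $ j" for j
  proof -
    have "axis j 1 \<in> P" by (rule mem[of "axis j 1" 0, simplified]) (simp add: axis_def)
    from yq[OF this] show ?thesis by (simp add: inner_axis)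
  qed
  have "y \<bullet> p \<le> 0"
    using dot[OF convex_cone_contains_0[OF cone]] by (simp add: y_def inner_diff_left)
  obtain l and a :: "real ^ 'n" where a: "\<forall>j. 0 \<le> a $ j" and p: "p = l *\<^sub>R v + a"
    using pP by (auto simp: P_def line_plus_orthant_iff)
  have "y \<bullet> a \<le> 0"
    using \<open>y \<bullet> p \<le> 0\<close> by (simp add: p inner_add_right yv)
  moreover have "y \<bullet> a = (\<Sum>j\<in>UNIV. y $ j * a $ j)" by (simp add: inner_vec_def)
  ultimately have "(\<Sum>j\<in>UNIV. y $ j * a $ j) = 0"
    using a y0 by (intro antisym sum_nonneg) auto
  then have ya: "y $ j * a $ j = 0" for j
    using a y0 by (subst (asm) sum_nonneg_eq_0_iff) auto
  have x: "x $ j = l * v $ j + a $ j - y $ j" for j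
    by (simp add: y_def p)
  define S where "S = {j. 0 < y $ j}"
  have yS: "y $ j = 0" if "j \<notin> S" for j
    using y0[of j] that by (auto simp: S_def)
  have aS: "a $ j = 0" if "j \<in> S" for j
    using ya[of j] that by (auto simp: S_def)
  have "S \<noteq> {}"
  proof
    assume "S = {}"
    then have "y = 0" using yS by (simp add: vec_eq_iff)
    then show False using pP xP by (simp add: y_def)
  qed
  have pos: "(\<Sum>j\<in>S. (v $ j)\<^sup>2) > 0"
    using v \<open>S \<noteq> {}\<close> by (intro sum_pos) auto
  have "0 = (\<Sum>j\<in>UNIV. y $ j * v $ j)" using yv by (simp add: inner_vec_def)
  also have "\<dots> = (\<Sum>j\<in>S. y $ j * v $ j)"
    by (intro sum.mono_neutral_right) (auto simp: yS)
  also have "\<dots> = (\<Sum>j\<in>S. (l * v $ j - x $ j) * v $ j)"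
    by (intro sum.cong) (auto simp: x aS)
  also have "\<dots> = l * (\<Sum>j\<in>S. (v $ j)\<^sup>2) - (\<Sum>j\<in>S. x $ j * v $ j)"
    by (simp add: algebra_simps sum_subtractf sum_distrib_left power2_eq_square)
  finally have l: "(\<Sum>j\<in>S. x $ j * v $ j) / (\<Sum>j\<in>S. (v $ j)\<^sup>2) = l"
    using pos by (simp add: field_simps)
  have "x $ j < l * v $ j" if "j \<in> S" for j
    using that aS[OF that] by (simp add: x S_def)
  moreover have "l * v $ j < x $ j" if "j \<notin> S" for j
    using generic[OF \<open>S \<noteq> {}\<close> that] a yS[OF that] unfolding l by (simp add: x order_less_le)
  ultimately have "x \<in> cell v S"
    by (simp only: cell_def Let_def l mem_Collect_eq) auto
  with \<open>S \<noteq> {}\<close> show thesis by (rule that)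
qed

section \<open>Intrinsic volumes\<close>

abbreviation face_event :: "int \<Rightarrow> (real ^ 'n) set \<Rightarrow> (real ^ 'n) set" where
  "face_event d C \<equiv> {x. \<exists>F. F face_of C \<and> aff_dim F = d \<and> closest_point C x \<in> rel_interior F}"

text \<open>Projection is continuous, there are finitely many faces, and a relative interior is
  relatively open in a closed affine hull.\<close>

lemma sets_face_event:
  fixes C :: "(real ^ 'n::finite) set"
  assumes C: "polyhedron C" "C \<noteq> {}"
  shows "face_event d C \<in> sets borel"
proof -
  have "closest_point C -` rel_interior F \<inter> space borel \<in> sets borel" for F
  proof (rule measurable_sets[where A = borel])
    show "closest_point C \<in> borel_measurable borel"
      using C by (intro borel_measurable_continuous_onI continuous_on_closest_point)
        (auto simp: polyhedron_imp_convex polyhedron_imp_closed)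
    obtain T where "open T" "rel_interior F = affine hull F \<inter> T"
      using openin_rel_interior[of F] by (auto simp: openin_open)
    then show "rel_interior F \<in> sets borel"
      by (simp add: closed_affine_hull)
  qed
  moreover have "face_event d C = (\<Union>F\<in>{F. F face_of C \<and> aff_dim F = d}. closest_point C -` rel_interior F \<inter> space borel)"
    by auto
  moreover have "finite {F. F face_of C \<and> aff_dim F = d}"
    using finite_polyhedron_faces[OF C(1)] by (rule rev_finite_subset) auto
  ultimately show ?thesis
    by (simp add: sets.finite_UN)
qed

text \<open>Take a minimal face containing p: were p on its relative frontier, a smaller face would
  contain p as well.\<close>

lemma mem_rel_interior_face_of_polyhedron:
  fixes C :: "'a::euclidean_space set"
  assumes C: "polyhedron C" "p \<in> C"
  obtains F where "F face_of C" "p \<in> rel_interior F"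
proof -
  let ?Fs = "{F. F face_of C \<and> p \<in> F}"
  have "C \<in> ?Fs" using C by (simp add: face_of_refl polyhedron_imp_convex)
  moreover have "finite ?Fs"
    using finite_polyhedron_faces[OF C(1)] by (rule rev_finite_subset) auto
  ultimately obtain F where F: "F \<in> ?Fs" and min: "\<And>E. E \<in> ?Fs \<Longrightarrow> E \<subseteq> F \<Longrightarrow> E = F"
    using finite_has_minimal[of ?Fs] by blast
  have poly: "polyhedron F"
    using F face_of_polyhedron_polyhedron[OF C(1)] by simp
  have "p \<in> rel_interior F"
  proof (rule ccontr)
    assume "p \<notin> rel_interior F"
    with F have "p \<in> rel_frontier F"
      using closure_subset by (auto simp: rel_frontier_def)
    then obtain E where E: "E face_of F" "E \<noteq> F" "p \<in> E"
      by (auto simp: rel_frontier_of_polyhedron_alt[OF poly])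
    then have "E \<in> ?Fs" using F face_of_trans by blast
    then show False using min E face_of_imp_subset by blast
  qed
  with F that show thesis by blast
qed

text \<open>The relative interiors of the nonempty faces partition the cone, so every x belongs to
  exactly one face event.\<close>

lemma sum_intrinsic_volume:
  fixes C :: "(real ^ 'n::finite) set"
  assumes C: "polyhedron C" "C \<noteq> {}"
  shows "(\<Sum>k = 0..CARD('n). intrinsic_volume k C) = 1"
proof -
  interpret G: prob_space "std_gaussian :: (real ^ 'n) measure" by (rule prob_space_std_gaussian)
  have "(\<Sum>k\<in>{0..CARD('n)}. intrinsic_volume k C) = measure std_gaussian (\<Union>k\<in>{0..CARD('n)}. face_event (int k) C)"
    unfolding intrinsic_volume_def
  proof (rule G.finite_measure_finite_Union[symmetric])
    show "disjoint_family_on (\<lambda>k. face_event (int k) C) {0..CARD('n)}"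
      unfolding disjoint_family_on_def
    proof (intro ballI impI, rule ccontr)
      fix k l :: nat assume "k \<noteq> l" "face_event (int k) C \<inter> face_event (int l) C \<noteq> {}"
      then obtain x F E where "F face_of C" "aff_dim F = int k" "closest_point C x \<in> rel_interior F"
          "E face_of C" "aff_dim E = int l" "closest_point C x \<in> rel_interior E" by blast
      moreover from this have "F = E" using face_of_eq[of F C E] by blast
      ultimately show False using \<open>k \<noteq> l\<close> by simp
    qed
  qed (auto simp: sets_face_event[OF C])
  also have "(\<Union>k\<in>{0..CARD('n)}. face_event (int k) C) = UNIV"
  proof (rule UNIV_eq_I[symmetric])
    fix x :: "real ^ 'n"
    have "closest_point C x \<in> C"
      using C by (intro closest_point_in_set polyhedron_imp_closed)
    then obtain F where F: "F face_of C" "closest_point C x \<in> rel_interior F"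
      using mem_rel_interior_face_of_polyhedron[OF C(1)] by blast
    then have "F \<noteq> {}" by auto
    then have "0 \<le> aff_dim F" using aff_dim_geq[of F] aff_dim_empty[of F] by linarith
    moreover have "aff_dim F \<le> int CARD('n)"
      using aff_dim_le_DIM[of F] by simp
    ultimately show "x \<in> (\<Union>k\<in>{0..CARD('n)}. face_event (int k) C)"
      using F by (auto intro!: bexI[of _ "nat (aff_dim F)"])
  qed
  also have "measure std_gaussian (UNIV :: (real ^ 'n) set) = 1"
    using G.prob_space by simp
  finally show ?thesis .
qed

text \<open>The cone contains a line, so it has no vertex: each point p is the midpoint of p + v and
  p - v.\<close>

lemma intrinsic_volume_0_line_plus_orthant:
  fixes v :: "real ^ 'n::finite"
  assumes "v \<noteq> 0"
  shows "intrinsic_volume 0 (span {v} + nonneg_orthant) = 0"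
proof -
  let ?P = "span {v} + (nonneg_orthant :: (real ^ 'n) set)"
  have False if F: "F face_of ?P" "aff_dim F = 0" for F
  proof -
    obtain p where p: "F = {p}" using F(2) aff_dim_eq_0 by blast
    then have "p \<in> ?P" using F(1) face_of_imp_subset by blast
    moreover have "v \<in> ?P" "- v \<in> ?P"
      using line_plus_orthantI[of 0 1 v] line_plus_orthantI[of 0 "-1" v] by auto
    ultimately have mem: "p + v \<in> ?P" "p + - v \<in> ?P"
      by (simp_all only: convex_cone_add[OF convex_cone_line_plus_orthant])
    have "midpoint (p + v) (p + - v) = p"
      by (simp add: midpoint_def scaleR_2[symmetric])
    then have "p \<in> open_segment (p + v) (p + - v)"
      using assms midpoint_in_open_segment[of "p + v" "p + - v"] by (simp add: eq_neg_iff_add_eq_0 scaleR_2[symmetric])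
    then have "p + v \<in> F" using face_ofD[OF F(1) _ mem, of p] p by blast
    then show False using p assms by simp
  qed
  then have "face_event (int 0) ?P = {}" by auto
  then show ?thesis unfolding intrinsic_volume_def by (simp only: measure_empty)
qed

lemma sets_cell [measurable]: "cell (v :: real ^ 'n::finite) S \<in> sets borel"
  unfolding cell_def Let_def by measurable

lemma AE_std_gaussian_not_on_cell_boundary:
  fixes v :: "real ^ 'n::finite"
  shows "AE x in std_gaussian. \<forall>S j. S \<noteq> {} \<longrightarrow> j \<notin> S \<longrightarrow>
    x $ j \<noteq> (\<Sum>j\<in>S. x $ j * v $ j) / (\<Sum>j\<in>S. (v $ j)\<^sup>2) * v $ j"
proof -
  have "AE x in std_gaussian. j \<notin> S \<longrightarrow> x $ j \<noteq> (\<Sum>j\<in>S. x $ j * v $ j) / (\<Sum>j\<in>S. (v $ j)\<^sup>2) * v $ j"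
    for S :: "'n set" and j
  proof (cases "j \<in> S")
    case False
    let ?a = "axis j 1 - (v $ j / (\<Sum>j\<in>S. (v $ j)\<^sup>2)) *\<^sub>R restrict_vec S v"
    \<comment> \<open>As j is outside \<open>S\<close>, this entry is 1.\<close>
    have "?a $ j \<noteq> 0" using False by (simp add: axis_def)
    then have "?a \<noteq> 0" by (metis zero_index)
    moreover have "?a \<bullet> x = x $ j - (\<Sum>j\<in>S. x $ j * v $ j) / (\<Sum>j\<in>S. (v $ j)\<^sup>2) * v $ j" for x
      by (subst inner_commute) (simp add: inner_diff_right inner_axis inner_restrict_vec)
    ultimately show ?thesis
      using AE_std_gaussian_inner_neq_0[of ?a] by simp
  qed simp
  then have "AE x in std_gaussian. \<forall>S j. j \<notin> S \<longrightarrow>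
      x $ j \<noteq> (\<Sum>j\<in>S. x $ j * v $ j) / (\<Sum>j\<in>S. (v $ j)\<^sup>2) * v $ j"
    by (intro AE_all_countable[THEN iffD2] allI)
  then show ?thesis by eventually_elim blast
qed

lemma AE_notin_frontier:
  assumes "convex (C :: (real ^ 'n::finite) set)"
  shows "AE x in std_gaussian. x \<notin> frontier C"
proof (rule AE_std_gaussian)
  have "frontier C \<in> null_sets lebesgue"
    using negligible_convex_frontier[OF assms] by (simp add: negligible_iff_null_sets)
  then have "frontier C \<in> null_sets lborel"
    by (subst (asm) null_sets_completion_iff) auto
  then show "AE x in lborel. x \<notin> frontier C" by (rule AE_not_in)
qed

lemma intrinsic_volume_line_plus_orthant:
  fixes v :: "real ^ 'n::finite"
  assumes v: "\<And>j. v $ j \<noteq> 0" and k: "1 \<le> k" "k < CARD('n)"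
  shows "intrinsic_volume (CARD('n) - k) (span {v} + nonneg_orthant) =
    (\<Sum>S | card S = k + 1. measure std_gaussian (cell v S))"
proof -
  interpret G: prob_space "std_gaussian :: (real ^ 'n) measure" by (rule prob_space_std_gaussian)
  define P where "P = span {v} + (nonneg_orthant :: (real ^ 'n) set)"
  have poly: "polyhedron P" unfolding P_def by (rule polyhedron_line_plus_orthant)
  have ne: "P \<noteq> {}" unfolding P_def by (rule convex_cone_nonempty[OF convex_cone_line_plus_orthant])
  have conv: "convex P" and cl: "closed P"
    using poly by (auto simp: polyhedron_imp_convex polyhedron_imp_closed)
  note cell = closest_point_cell[OF v, folded P_def]
  have dim: "aff_dim (orthant_face v S) = int (CARD('n) - k) \<longleftrightarrow> card S = k + 1" if "S \<noteq> {}" for S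
  proof -
    have "card S \<le> CARD('n)" by (rule card_mono) auto
    then show ?thesis
      using aff_dim_orthant_face[OF v that] k by auto
  qed
  have "AE x in std_gaussian. x \<in> face_event (int (CARD('n) - k)) P \<longleftrightarrow> x \<in> (\<Union>S\<in>{S. card S = k + 1}. cell v S)"
    using AE_std_gaussian_not_on_cell_boundary[of v] AE_notin_frontier[OF conv]
  proof eventually_elim
    case (elim x)
    show ?case
    proof
      assume "x \<in> (\<Union>S\<in>{S. card S = k + 1}. cell v S)"
      then obtain S where S: "card S = k + 1" "x \<in> cell v S" by auto
      then have "S \<noteq> {}" by auto
      from cell[OF this S(2)] dim[OF this] S(1) show "x \<in> face_event (int (CARD('n) - k)) P"
        by blast
    next
      assume "x \<in> face_event (int (CARD('n) - k)) P"
      then obtain F where F: "F face_of P" "aff_dim F = int (CARD('n) - k)" "closest_point P x \<in> rel_interior F"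
        by auto
      show "x \<in> (\<Union>S\<in>{S. card S = k + 1}. cell v S)"
      proof (cases "x \<in> P")
        \<comment> \<open>Almost every point of the cone is interior and is its own projection, so
          its face is the whole cone, of dimension n; this is excluded by
          \<open>1 \<le> k\<close>.\<close>
        case True
        then have int: "x \<in> interior P"
          using elim(2) cl by (simp add: frontier_def)
        have "x \<in> F"
          using F(3) True rel_interior_subset by (auto simp: closest_point_self)
        then have "F = P"
          using face_of_disjoint_interior[OF F(1)] int by blast
        moreover have "aff_dim P = int CARD('n)"
          using int aff_dim_nonempty_interior[of P] by auto
        ultimately show ?thesis using F(2) k by simp
      next
        case False
        then obtain S where S: "S \<noteq> {}" "x \<in> cell v S"
          using mem_cell_if_not_mem[of v x] v elim(1) unfolding P_def by metis
        then have "F = orthant_face v S"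
          using face_of_eq[OF F(1) cell(2)[OF S]] F(3) cell(3)[OF S] by blast
        then show ?thesis using F(2) dim[OF S(1)] S by auto
      qed
    qed
  qed
  then have "measure std_gaussian (face_event (int (CARD('n) - k)) P) =
      measure std_gaussian (\<Union>S\<in>{S. card S = k + 1}. cell v S)"
    by (intro G.finite_measure_eq_AE) (auto simp: sets_face_event[OF poly ne])
  also have "\<dots> = (\<Sum>S | card S = k + 1. measure std_gaussian (cell v S))"
  proof (rule G.finite_measure_finite_Union)
    show "disjoint_family_on (cell v) {S. card S = k + 1}"
      unfolding disjoint_family_on_def
    proof (intro ballI impI, rule ccontr)
      fix S T assume ST: "S \<in> {S. card S = k + 1}" "T \<in> {S. card S = k + 1}" "S \<noteq> T"
        "cell v S \<inter> cell v T \<noteq> {}"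
      then obtain x where "x \<in> cell v S" "x \<in> cell v T" by auto
      moreover have "S \<noteq> {}" "T \<noteq> {}" using ST by auto
      ultimately show False using cell(1)[of S x] cell(1)[of T x] ST(3) by blast
    qed
  qed auto
  finally show ?thesis by (simp add: intrinsic_volume_def P_def)
qed

text \<open>A cell is unchanged when v is scaled by a positive factor, so v may be normalized to
  have norm 1 on \<open>S\<close>.\<close>

lemma measure_cell:
  fixes v :: "real ^ 'n::finite"
  assumes v: "\<And>j. v $ j \<noteq> 0" and S: "2 \<le> card S"
  shows "of_real (measure std_gaussian (cell v S)) =
    (LINT y|std_normal_distribution. (\<Prod>j\<in>S. Phi (\<i> * of_real (y * v $ j / norm_on S v)))) *
    (LINT y|std_normal_distribution. (\<Prod>j\<in>-S. Phi (of_real (y * v $ j / norm_on S v))))"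
proof -
  define N where "N = norm_on S v"
  have "S \<noteq> {}" using S by auto
  then have pos: "(\<Sum>j\<in>S. (v $ j)\<^sup>2) > 0"
    using v by (intro sum_pos) auto
  then have N: "N > 0" "N\<^sup>2 = (\<Sum>j\<in>S. (v $ j)\<^sup>2)"
    by (auto simp: N_def norm_on_def)
  define u where "u = (1 / N) *\<^sub>R v"
  have u: "u $ j = v $ j / N" for j by (simp add: u_def)
  have "(\<Sum>j\<in>S. (u $ j)\<^sup>2) = (\<Sum>j\<in>S. (v $ j)\<^sup>2) / N\<^sup>2"
    by (simp add: u power_divide sum_divide_distrib)
  then have u1: "(\<Sum>j\<in>S. (u $ j)\<^sup>2) = 1" using N pos by simp
  have "(x \<bullet> restrict_vec S u) * u $ j = (\<Sum>j\<in>S. x $ j * v $ j) / (\<Sum>j\<in>S. (v $ j)\<^sup>2) * v $ j" for x j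
    unfolding inner_restrict_vec N(2)[symmetric]
    by (simp add: u sum_divide_distrib[symmetric] power2_eq_square)
  then have "cell v S = {x. (\<forall>j\<in>S. x $ j < (x \<bullet> restrict_vec S u) * u $ j) \<and> (\<forall>j\<in>-S. (x \<bullet> restrict_vec S u) * u $ j < x $ j)}"
    by (simp add: cell_def Let_def)
  moreover have "u $ j \<noteq> 0" for j using v N(1) by (simp add: u)
  ultimately show ?thesis
    using measure_std_gaussian_cell[OF u1 S] by (simp add: u N_def)
qed

section \<open>Transfer to the given random variable and splitting of S by sign\<close>

theorem theorem6:
  fixes v :: "real ^ 'n" and P :: "(real ^ 'n) set"
    and M :: "'w measure" and g :: "'w \<Rightarrow> real"
  assumes nonzero: "\<forall>j. v $ j \<noteq> 0"
    and not_all_pos: "\<not> (\<forall>j. v $ j > 0)"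
    and not_all_neg: "\<not> (\<forall>j. v $ j < 0)"
    and P: "P = span {v} + nonneg_orthant"
    and M: "prob_space M"
    and g: "distributed M lborel g std_normal_density"
  shows "(\<forall>k\<in>{1..CARD('n) - 1}.
      complex_of_real (intrinsic_volume (CARD('n) - k) P) =
        (\<Sum>(L, R)\<in>{(L, R). L \<subseteq> {l. v $ l > 0} \<and> R \<subseteq> {r. v $ r < 0} \<and> card L + card R = k + 1}.
          (LINT \<omega>|M. (\<Prod>j\<in>L \<union> R. Phi (\<i> * complex_of_real (g \<omega> * v $ j / norm_on (L \<union> R) v)))) *
          (LINT \<omega>|M. (\<Prod>j\<in>UNIV - (L \<union> R). Phi (complex_of_real (g \<omega> * v $ j / norm_on (L \<union> R) v))))))
    \<and> intrinsic_volume 0 P = 0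
    \<and> intrinsic_volume CARD('n) P = 1 - (\<Sum>k = 0..CARD('n) - 1. intrinsic_volume k P)"
proof (intro conjI ballI)
  have v: "\<And>j. v $ j \<noteq> 0" using nonzero by blast
  have g_meas [measurable]: "g \<in> borel_measurable M"
    using distributed_measurable[OF g] by simp
  have distr: "distr M borel g = std_normal_distribution"
    using distributed_distr_eq_density[OF g] by (simp cong: distr_cong)
  have E: "(LINT \<omega>|M. f (g \<omega>)) = (LINT y|std_normal_distribution. f y)"
    if [measurable]: "f \<in> borel_measurable borel" for f :: "real \<Rightarrow> complex"
    by (simp add: integral_distr flip: distr)
  {
    fix k assume k: "k \<in> {1..CARD('n) - 1}"
    let ?A = "{(L, R). L \<subseteq> {l. v $ l > 0} \<and> R \<subseteq> {r. v $ r < 0} \<and> card L + card R = k + 1}"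
    let ?f = "\<lambda>S. (LINT \<omega>|M. (\<Prod>j\<in>S. Phi (\<i> * complex_of_real (g \<omega> * v $ j / norm_on S v)))) *
          (LINT \<omega>|M. (\<Prod>j\<in>UNIV - S. Phi (complex_of_real (g \<omega> * v $ j / norm_on S v))))"
    have "complex_of_real (intrinsic_volume (CARD('n) - k) P) =
        (\<Sum>S | card S = k + 1. of_real (measure std_gaussian (cell v S)))"
    proof -
      have "1 \<le> k" "k < CARD('n)" using k by auto
      from intrinsic_volume_line_plus_orthant[OF v this] show ?thesis
        unfolding P by (simp only: of_real_sum)
    qed
    also have "\<dots> = (\<Sum>S | card S = k + 1. ?f S)"
    proof (rule sum.cong[OF refl])
      fix S assume "S \<in> {S :: 'n set. card S = k + 1}"
      \<comment> \<open>The lower bound on k is what supplies the two indices required by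
        \<open>measure_cell\<close>.\<close>
      with k have "2 \<le> card S" by auto
      then show "of_real (measure std_gaussian (cell v S)) = ?f S"
        unfolding Compl_eq_Diff_UNIV[symmetric] measure_cell[OF v \<open>2 \<le> card S\<close>]
        by (intro arg_cong2[where f = "(*)"] E[symmetric]) measurable
    qed
    also have "\<dots> = (\<Sum>(L, R)\<in>?A. ?f (L \<union> R))"
    proof (rule sum.reindex_bij_witness[where
        i = "\<lambda>(L, R). L \<union> R" and j = "\<lambda>S. (S \<inter> {l. v $ l > 0}, S \<inter> {r. v $ r < 0})"])
      fix S assume S: "S \<in> {S :: 'n set. card S = k + 1}"
      \<comment> \<open>No entry of v is zero, so the positive and negative parts of
        \<open>S\<close> exhaust it.\<close>
      have un: "S \<inter> {l. v $ l > 0} \<union> S \<inter> {r. v $ r < 0} = S"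
        using v by (auto simp: neq_iff)
      moreover have "card (S \<inter> {l. v $ l > 0}) + card (S \<inter> {r. v $ r < 0}) =
          card (S \<inter> {l. v $ l > 0} \<union> S \<inter> {r. v $ r < 0})"
        by (rule card_Un_disjoint[symmetric]) auto
      ultimately show "(S \<inter> {l. v $ l > 0}, S \<inter> {r. v $ r < 0}) \<in> ?A" using S by simp
      show "(case (S \<inter> {l. v $ l > 0}, S \<inter> {r. v $ r < 0}) of (L, R) \<Rightarrow> L \<union> R) = S"
        and "(case (S \<inter> {l. v $ l > 0}, S \<inter> {r. v $ r < 0}) of (L, R) \<Rightarrow> ?f (L \<union> R)) = ?f S"
        by (simp_all only: prod.case un)
    next
      fix LR assume "LR \<in> ?A"
      then obtain L R where LR: "LR = (L, R)" "L \<subseteq> {l. v $ l > 0}" "R \<subseteq> {r. v $ r < 0}" "card L + card R = k + 1"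
        by auto
      have "card (L \<union> R) = card L + card R"
        by (rule card_Un_disjoint) (use LR in fastforce)+
      then show "(case LR of (L, R) \<Rightarrow> L \<union> R) \<in> {S. card S = k + 1}" using LR by simp
      show "((case LR of (L, R) \<Rightarrow> L \<union> R) \<inter> {l. v $ l > 0}, (case LR of (L, R) \<Rightarrow> L \<union> R) \<inter> {r. v $ r < 0}) = LR"
        using LR by fastforce
    qed
    finally show "complex_of_real (intrinsic_volume (CARD('n) - k) P) = (\<Sum>(L, R)\<in>?A. ?f (L \<union> R))" .
  }
  have "v \<noteq> 0" using v[of undefined] by auto
  then show "intrinsic_volume 0 P = 0"
    unfolding P by (rule intrinsic_volume_0_line_plus_orthant)
  have "{0..CARD('n)} = insert CARD('n) {0..CARD('n) - 1}" by auto
  then have "(\<Sum>k = 0..CARD('n). intrinsic_volume k P) =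
      intrinsic_volume CARD('n) P + (\<Sum>k = 0..CARD('n) - 1. intrinsic_volume k P)"
    by (simp add: not_le)
  moreover have "(\<Sum>k = 0..CARD('n). intrinsic_volume k P) = 1"
    unfolding P by (rule sum_intrinsic_volume[OF polyhedron_line_plus_orthant
          convex_cone_nonempty[OF convex_cone_line_plus_orthant]])
  ultimately show "intrinsic_volume CARD('n) P = 1 - (\<Sum>k = 0..CARD('n) - 1. intrinsic_volume k P)"
    by simp
qed

end
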